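(* Let $R$ be an integral domain, let $\mathcal{C},\mathcal{C}',\mathcal{D}$ be additive categories enriched over $\mathrm{Mod}_R$ such that $\mathcal{D}$ admits countable products, let $\xi\in R$ and $N\in\mathbb{N}$ be such that $(\mathcal{D},N,\xi)$ allows the twisted Leibniz rule, and let $F(\_,\_):\mathcal{C}^{op}\otimes_{\mathrm{Mod}_R}\mathcal{C}'\to\mathcal{D}$ be an $R$-linear bifunctor. Then the functor $F_\xi(\_,\_):\mathrm{C}_\infty(\mathcal{C})^{op}\times\mathrm{C}_\infty(\mathcal{C}')\to\mathrm{C}_\infty(\mathcal{D})$ induces a functor $$F_\xi(\_,\_):\mathrm{C}_N(\mathcal{C})^{op}\times\mathrm{C}_N(\mathcal{C}')\to\mathrm{C}_N(\mathcal{D}).$$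
   Context: For a category $\mathcal{C}$, an $\infty$-complex in $\mathcal{C}$ is a $\mathbb{Z}$-indexed diagram $\cdots\to X^{n-1}\xrightarrow{d_X}X^n\xrightarrow{d_X}X^{n+1}\to\cdots$ with no condition on $d_X$; a morphism is a family $g^i:X^i\to Y^i$ ($i\in\mathbb{Z}$) commuting with the differentials. These form $\mathrm{C}_\infty(\mathcal{C})$. If $\mathcal{C}$ has a zero object, an $N$-complex is an $\infty$-complex with $d_X^N=0$; $\mathrm{C}_N(\mathcal{C})$ is the full subcategory of $N$-complexes. For categories $\mathcal{A},\mathcal{B}$ enriched over $\mathrm{Mod}_R$, $\mathcal{A}\otimes_{\mathrm{Mod}_R}\mathcal{B}$ has objects pairs $(X,Y)$ and morphism modules $\mathcal{A}(X_1,X_2)\otimes_R\mathcal{B}(Y_1,Y_2)$; an $R$-linear functor on it is an $R$-bilinear bifunctor. The functor $F_\xi$ (contravariant in the first, covariant in the second variable): for $\infty$-complexes $X$ in $\mathcal{C}$ and $Y$ in $\mathcal{C}'$, $$F_\xi(X,Y)^i:=\prod_{j\in\mathbb{Z}}F(X^j,Y^{i+j}),$$ with differential $d_{F_\xi(X,Y)}:F_\xi(X,Y)^{i-1}\to F_\xi(X,Y)^{i}$ given on factors by $$\pi_{j,i+j}\circ d_{F_\xi(X,Y)}:=F(X^j,d_Y)\circ\pi_{j,i+j-1}-\xi^{i-1}F(d_X,Y^{i+j})\circ\pi_{j+1,i+j},$$ where $\pi_{k,l}:\prod_{j}F(X^j,Y^{(l-k)+j})\to F(X^k,Y^l)$ is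 the canonical projection. On morphisms, $F_\xi(f,Y)^i:=\prod_{j}F(f^j,Y^{i+j})$ and $F_\xi(X,f)^i:=\prod_{j}F(X^j,f^{i+j})$. A triple $(\mathcal{D},N,\xi)$, with $\mathcal{D}$ an additive category enriched over $\mathrm{Mod}_R$, $N\in\mathbb{N}$, $\xi\in R$, allows the twisted Leibniz rule if one of the following holds: (i) every morphism $f$ in $\mathcal{D}$ satisfies $pf=0$ for a fixed prime $p$, $\xi=1$ and $N=p^n$ for some $n\in\mathbb{N}$; (ii) $\xi$ is a primitive $N$-th root of unity in $R$ (i.e. $\xi^N=1$ and $\xi^j\ne1$ for $0<j<N$); (iii) every morphism $f$ in $\mathcal{D}$ satisfies $pf=0$ for a fixed prime $p$, $\xi$ is a primitive $k$-th root of unity in $R$, and $N=p^nk$ for some $n\in\mathbb{N}$. *)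

theory Defs
  imports "HOL-Algebra.Module" "HOL-Computational_Algebra.Primes"
begin

section \<open>Categories and functors\<close>

text \<open>
  Hom-sets are indexed by pairs of objects and are not required to be disjoint, so composition
  carries its three objects: for \<open>f : X \<rightarrow> Y\<close> and \<open>g : Y \<rightarrow> Z\<close>, the composite \<open>g \<circ> f\<close> is
  \<open>Comp C X Y Z g f\<close>.  For the same reason functors act on \<open>X\<close>, \<open>Y\<close> and a morphism \<open>X \<rightarrow> Y\<close>.
\<close>

record ('o, 'm) cat =
  Obj :: "'o set"
  Hom :: "'o \<Rightarrow> 'o \<Rightarrow> 'm set"
  Comp :: "'o \<Rightarrow> 'o \<Rightarrow> 'o \<Rightarrow> 'm \<Rightarrow> 'm \<Rightarrow> 'm"
  Ident :: "'o \<Rightarrow> 'm"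

locale category =
  fixes C :: "('o, 'm, 'z) cat_scheme"
  assumes Ident_closed: "X \<in> Obj C \<Longrightarrow> Ident C X \<in> Hom C X X"
    and Comp_closed: "\<lbrakk>X \<in> Obj C; Y \<in> Obj C; Z \<in> Obj C; f \<in> Hom C X Y; g \<in> Hom C Y Z\<rbrakk>
      \<Longrightarrow> Comp C X Y Z g f \<in> Hom C X Z"
    and Comp_Ident_right: "\<lbrakk>X \<in> Obj C; Y \<in> Obj C; f \<in> Hom C X Y\<rbrakk>
      \<Longrightarrow> Comp C X X Y f (Ident C X) = f"
    and Comp_Ident_left: "\<lbrakk>X \<in> Obj C; Y \<in> Obj C; f \<in> Hom C X Y\<rbrakk>
      \<Longrightarrow> Comp C X Y Y (Ident C Y) f = f"
    and Comp_assoc: "\<lbrakk>W \<in> Obj C; X \<in> Obj C; Y \<in> Obj C; Z \<in> Obj C;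
        f \<in> Hom C W X; g \<in> Hom C X Y; h \<in> Hom C Y Z\<rbrakk>
      \<Longrightarrow> Comp C W Y Z h (Comp C W X Y g f) = Comp C W X Z (Comp C X Y Z h g) f"

definition op_cat :: "('o, 'm, 'z) cat_scheme \<Rightarrow> ('o, 'm) cat" where
  "op_cat C = \<lparr>Obj = Obj C, Hom = (\<lambda>X Y. Hom C Y X),
     Comp = (\<lambda>X Y Z g f. Comp C Z Y X f g), Ident = Ident C\<rparr>"

definition prod_cat ::
  "('o, 'm, 'z) cat_scheme \<Rightarrow> ('p, 'n, 'y) cat_scheme \<Rightarrow> ('o \<times> 'p, 'm \<times> 'n) cat" where
  "prod_cat A B = \<lparr>Obj = Obj A \<times> Obj B,
     Hom = (\<lambda>X Y. Hom A (fst X) (fst Y) \<times> Hom B (snd X) (snd Y)),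
     Comp = (\<lambda>X Y Z g f. (Comp A (fst X) (fst Y) (fst Z) (fst g) (fst f),
                         Comp B (snd X) (snd Y) (snd Z) (snd g) (snd f))),
     Ident = (\<lambda>X. (Ident A (fst X), Ident B (snd X)))\<rparr>"

definition full_subcat :: "('o, 'm, 'z) cat_scheme \<Rightarrow> ('o \<Rightarrow> bool) \<Rightarrow> ('o, 'm) cat" where
  "full_subcat C P = \<lparr>Obj = {X \<in> Obj C. P X}, Hom = Hom C, Comp = Comp C, Ident = Ident C\<rparr>"

record ('o, 'm, 'p, 'n) func =
  fobj :: "'o \<Rightarrow> 'p"
  fmor :: "'o \<Rightarrow> 'o \<Rightarrow> 'm \<Rightarrow> 'n"

locale is_functor = A: category A + B: category B
  for A :: "('o, 'm, 'z) cat_scheme" and B :: "('p, 'n, 'y) cat_scheme" +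
  fixes F :: "('o, 'm, 'p, 'n) func"
  assumes fobj_closed: "X \<in> Obj A \<Longrightarrow> fobj F X \<in> Obj B"
    and fmor_closed: "\<lbrakk>X \<in> Obj A; Y \<in> Obj A; f \<in> Hom A X Y\<rbrakk>
      \<Longrightarrow> fmor F X Y f \<in> Hom B (fobj F X) (fobj F Y)"
    and fmor_Ident: "X \<in> Obj A \<Longrightarrow> fmor F X X (Ident A X) = Ident B (fobj F X)"
    and fmor_Comp: "\<lbrakk>X \<in> Obj A; Y \<in> Obj A; Z \<in> Obj A; f \<in> Hom A X Y; g \<in> Hom A Y Z\<rbrakk>
      \<Longrightarrow> fmor F X Z (Comp A X Y Z g f)
        = Comp B (fobj F X) (fobj F Y) (fobj F Z) (fmor F Y Z g) (fmor F X Y f)"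

definition zero_object :: "('o, 'm, 'z) cat_scheme \<Rightarrow> 'o \<Rightarrow> bool" where
  "zero_object C Z \<longleftrightarrow> Z \<in> Obj C \<and>
     (\<forall>X\<in>Obj C. (\<exists>!f. f \<in> Hom C X Z) \<and> (\<exists>!f. f \<in> Hom C Z X))"

definition zero_morphism :: "('o, 'm, 'z) cat_scheme \<Rightarrow> 'o \<Rightarrow> 'o \<Rightarrow> 'm \<Rightarrow> bool" where
  "zero_morphism C X Y f \<longleftrightarrow>
     (\<exists>Z g h. zero_object C Z \<and> g \<in> Hom C X Z \<and> h \<in> Hom C Z Y \<and> f = Comp C X Z Y h g)"


section \<open>Products\<close>

definition is_product ::
  "('o, 'm, 'z) cat_scheme \<Rightarrow> 'i set \<Rightarrow> ('i \<Rightarrow> 'o) \<Rightarrow> 'o \<Rightarrow> ('i \<Rightarrow> 'm) \<Rightarrow> bool" where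
  "is_product C I X P pr \<longleftrightarrow> P \<in> Obj C \<and> (\<forall>i\<in>I. pr i \<in> Hom C P (X i)) \<and>
     (\<forall>A\<in>Obj C. \<forall>g. (\<forall>i\<in>I. g i \<in> Hom C A (X i)) \<longrightarrow>
        (\<exists>!h. h \<in> Hom C A P \<and> (\<forall>i\<in>I. Comp C A P (X i) (pr i) h = g i)))"

text \<open>Every countable family is, up to reindexing, indexed by a set of natural numbers.\<close>

definition has_countable_products :: "('o, 'm, 'z) cat_scheme \<Rightarrow> bool" where
  "has_countable_products C \<longleftrightarrow>
     (\<forall>(I :: nat set) X. (\<forall>i\<in>I. X i \<in> Obj C) \<longrightarrow> (\<exists>P pr. is_product C I X P pr))"

text \<open>
  A choice of product for every family that has one, with its projections; \<open>prod_tuple\<close> is the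
  morphism into the product with prescribed components, \<open>prod_map\<close> the product of morphisms.
\<close>

definition chosen_product ::
  "('o, 'm, 'z) cat_scheme \<Rightarrow> 'i set \<Rightarrow> ('i \<Rightarrow> 'o) \<Rightarrow> 'o \<times> ('i \<Rightarrow> 'm)" where
  "chosen_product C I X = (SOME (P, pr). is_product C I X P pr)"

definition prod_obj :: "('o, 'm, 'z) cat_scheme \<Rightarrow> 'i set \<Rightarrow> ('i \<Rightarrow> 'o) \<Rightarrow> 'o" where
  "prod_obj C I X = fst (chosen_product C I X)"

definition prod_proj :: "('o, 'm, 'z) cat_scheme \<Rightarrow> 'i set \<Rightarrow> ('i \<Rightarrow> 'o) \<Rightarrow> 'i \<Rightarrow> 'm" where
  "prod_proj C I X = snd (chosen_product C I X)"

definition prod_tuple ::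
  "('o, 'm, 'z) cat_scheme \<Rightarrow> 'i set \<Rightarrow> ('i \<Rightarrow> 'o) \<Rightarrow> 'o \<Rightarrow> ('i \<Rightarrow> 'm) \<Rightarrow> 'm" where
  "prod_tuple C I X A g = (THE h. h \<in> Hom C A (prod_obj C I X) \<and>
     (\<forall>i\<in>I. Comp C A (prod_obj C I X) (X i) (prod_proj C I X i) h = g i))"

definition prod_map ::
  "('o, 'm, 'z) cat_scheme \<Rightarrow> 'i set \<Rightarrow> ('i \<Rightarrow> 'o) \<Rightarrow> ('i \<Rightarrow> 'o) \<Rightarrow> ('i \<Rightarrow> 'm) \<Rightarrow> 'm" where
  "prod_map C I X Y g = prod_tuple C I Y (prod_obj C I X)
     (\<lambda>i. Comp C (prod_obj C I X) (X i) (Y i) (g i) (prod_proj C I X i))"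


section \<open>Additive categories enriched over modules\<close>

text \<open>The multiplication and unit of the record \<^term>\<open>HomM C X Y\<close> are irrelevant.\<close>

record ('o, 'm, 'r) lin_cat = "('o, 'm) cat" +
  HomM :: "'o \<Rightarrow> 'o \<Rightarrow> ('r, 'm) module"

definition linear_map ::
  "('r, 'x) ring_scheme \<Rightarrow> ('r, 'm, 'y) module_scheme \<Rightarrow> ('r, 'n, 'z) module_scheme
     \<Rightarrow> ('m \<Rightarrow> 'n) \<Rightarrow> bool" where
  "linear_map R M M' f \<longleftrightarrow> f \<in> carrier M \<rightarrow> carrier M' \<and>
     (\<forall>x\<in>carrier M. \<forall>y\<in>carrier M. f (x \<oplus>\<^bsub>M\<^esub> y) = f x \<oplus>\<^bsub>M'\<^esub> f y) \<and>
     (\<forall>a\<in>carrier R. \<forall>x\<in>carrier M. f (a \<odot>\<^bsub>M\<^esub> x) = a \<odot>\<^bsub>M'\<^esub> f x)"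

locale linear_category = category C
  for R :: "('r, 'x) ring_scheme" and C :: "('o, 'm, 'r, 'z) lin_cat_scheme" +
  assumes HomM_module: "\<lbrakk>X \<in> Obj C; Y \<in> Obj C\<rbrakk> \<Longrightarrow> module R (HomM C X Y)"
    and carrier_HomM: "\<lbrakk>X \<in> Obj C; Y \<in> Obj C\<rbrakk> \<Longrightarrow> carrier (HomM C X Y) = Hom C X Y"
    and Comp_linear_right: "\<lbrakk>X \<in> Obj C; Y \<in> Obj C; Z \<in> Obj C; g \<in> Hom C Y Z\<rbrakk>
      \<Longrightarrow> linear_map R (HomM C X Y) (HomM C X Z) (\<lambda>f. Comp C X Y Z g f)"
    and Comp_linear_left: "\<lbrakk>X \<in> Obj C; Y \<in> Obj C; Z \<in> Obj C; f \<in> Hom C X Y\<rbrakk>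
      \<Longrightarrow> linear_map R (HomM C Y Z) (HomM C X Z) (\<lambda>g. Comp C X Y Z g f)"

definition is_biproduct ::
  "('o, 'm, 'r, 'z) lin_cat_scheme \<Rightarrow> 'o \<Rightarrow> 'o \<Rightarrow> 'o \<Rightarrow> 'm \<Rightarrow> 'm \<Rightarrow> 'm \<Rightarrow> 'm \<Rightarrow> bool" where
  "is_biproduct C X Y S i1 i2 p1 p2 \<longleftrightarrow> S \<in> Obj C \<and>
     i1 \<in> Hom C X S \<and> i2 \<in> Hom C Y S \<and> p1 \<in> Hom C S X \<and> p2 \<in> Hom C S Y \<and>
     Comp C X S X p1 i1 = Ident C X \<and> Comp C Y S Y p2 i2 = Ident C Y \<and>
     Comp C Y S X p1 i2 = \<zero>\<^bsub>HomM C Y X\<^esub> \<and> Comp C X S Y p2 i1 = \<zero>\<^bsub>HomM C X Y\<^esub> \<and>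
     Comp C S X S i1 p1 \<oplus>\<^bsub>HomM C S S\<^esub> Comp C S Y S i2 p2 = Ident C S"

locale additive_category = linear_category R C
  for R :: "('r, 'x) ring_scheme" and C :: "('o, 'm, 'r, 'z) lin_cat_scheme" +
  assumes ex_zero_object: "\<exists>Z. zero_object C Z"
    and ex_biproduct: "\<lbrakk>X \<in> Obj C; Y \<in> Obj C\<rbrakk>
      \<Longrightarrow> \<exists>S i1 i2 p1 p2. is_biproduct C X Y S i1 i2 p1 p2"

text \<open>
  An \<open>R\<close>-linear functor on the tensor product of \<open>A\<^sup>o\<^sup>p\<close> and \<open>B\<close> is a functor on \<open>A\<^sup>o\<^sup>p \<times> B\<close> that is
  \<open>R\<close>-bilinear on the hom-modules \<open>A(X', X) \<times> B(Y, Y')\<close>.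
\<close>

locale linear_bifunctor = is_functor "prod_cat (op_cat A) B" D F
  for R :: "('r, 'x) ring_scheme" and A :: "('o, 'm, 'r, 'z) lin_cat_scheme"
    and B :: "('o', 'm', 'r, 'z') lin_cat_scheme" and D :: "('p, 'n, 'r, 'y) lin_cat_scheme"
    and F :: "('o \<times> 'o', 'm \<times> 'm', 'p, 'n) func" +
  assumes linear_first: "\<lbrakk>X \<in> Obj A; X' \<in> Obj A; Y \<in> Obj B; Y' \<in> Obj B; g \<in> Hom B Y Y'\<rbrakk>
      \<Longrightarrow> linear_map R (HomM A X' X) (HomM D (fobj F (X, Y)) (fobj F (X', Y')))
            (\<lambda>f. fmor F (X, Y) (X', Y') (f, g))"
    and linear_second: "\<lbrakk>X \<in> Obj A; X' \<in> Obj A; Y \<in> Obj B; Y' \<in> Obj B; f \<in> Hom A X' X\<rbrakk>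
      \<Longrightarrow> linear_map R (HomM B Y Y') (HomM D (fobj F (X, Y)) (fobj F (X', Y')))
            (\<lambda>g. fmor F (X, Y) (X', Y') (f, g))"


section \<open>Complexes\<close>

record ('o, 'm) cplx =
  term_at :: "int \<Rightarrow> 'o"
  diff_at :: "int \<Rightarrow> 'm"

definition C_inf :: "('o, 'm, 'z) cat_scheme \<Rightarrow> (('o, 'm) cplx, int \<Rightarrow> 'm) cat" where
  "C_inf C = \<lparr>
     Obj = {X. \<forall>i. term_at X i \<in> Obj C \<and> diff_at X i \<in> Hom C (term_at X i) (term_at X (i + 1))},
     Hom = (\<lambda>X Y. {g. \<forall>i. g i \<in> Hom C (term_at X i) (term_at Y i) \<and>
       Comp C (term_at X i) (term_at Y i) (term_at Y (i + 1)) (diff_at Y i) (g i)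
       = Comp C (term_at X i) (term_at X (i + 1)) (term_at Y (i + 1)) (g (i + 1)) (diff_at X i)}),
     Comp = (\<lambda>X Y Z g f i. Comp C (term_at X i) (term_at Y i) (term_at Z i) (g i) (f i)),
     Ident = (\<lambda>X i. Ident C (term_at X i))\<rparr>"

text \<open>The iterated differential \<open>X\<^sup>i \<rightarrow> X\<^sup>i\<^sup>+\<^sup>n\<close>.\<close>

fun diff_pow :: "('o, 'm, 'z) cat_scheme \<Rightarrow> ('o, 'm) cplx \<Rightarrow> nat \<Rightarrow> int \<Rightarrow> 'm" where
  "diff_pow C X 0 i = Ident C (term_at X i)"
| "diff_pow C X (Suc n) i =
     Comp C (term_at X i) (term_at X (i + int n)) (term_at X (i + int n + 1))
       (diff_at X (i + int n)) (diff_pow C X n i)"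

definition C_N :: "nat \<Rightarrow> ('o, 'm, 'z) cat_scheme \<Rightarrow> (('o, 'm) cplx, int \<Rightarrow> 'm) cat" where
  "C_N N C = full_subcat (C_inf C)
     (\<lambda>X. \<forall>i. zero_morphism C (term_at X i) (term_at X (i + int N)) (diff_pow C X N i))"


section \<open>The twisted Leibniz rule\<close>

definition primitive_root :: "('r, 'x) ring_scheme \<Rightarrow> nat \<Rightarrow> 'r \<Rightarrow> bool" where
  "primitive_root R k \<xi> \<longleftrightarrow> 0 < k \<and> \<xi> \<in> carrier R \<and> \<xi> [^]\<^bsub>R\<^esub> k = \<one>\<^bsub>R\<^esub> \<and>
     (\<forall>j::nat. 0 < j \<and> j < k \<longrightarrow> \<xi> [^]\<^bsub>R\<^esub> j \<noteq> \<one>\<^bsub>R\<^esub>)"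

definition killed_by :: "nat \<Rightarrow> ('o, 'm, 'r, 'z) lin_cat_scheme \<Rightarrow> bool" where
  "killed_by p D \<longleftrightarrow> (\<forall>X\<in>Obj D. \<forall>Y\<in>Obj D. \<forall>f\<in>Hom D X Y.
     [p] \<cdot>\<^bsub>HomM D X Y\<^esub> f = \<zero>\<^bsub>HomM D X Y\<^esub>)"

definition allows_twisted_Leibniz ::
  "('r, 'x) ring_scheme \<Rightarrow> ('o, 'm, 'r, 'z) lin_cat_scheme \<Rightarrow> nat \<Rightarrow> 'r \<Rightarrow> bool" where
  "allows_twisted_Leibniz R D N \<xi> \<longleftrightarrow>
     (\<exists>p n. prime p \<and> killed_by p D \<and> \<xi> = \<one>\<^bsub>R\<^esub> \<and> N = p ^ n) \<or>
     primitive_root R N \<xi> \<or>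
     (\<exists>p n k. prime p \<and> killed_by p D \<and> primitive_root R k \<xi> \<and> N = p ^ n * k)"


section \<open>The functor on complexes\<close>

text \<open>
  \<open>F_fam F X Y i\<close> is the family \<open>j \<mapsto> F(X\<^sup>j, Y\<^sup>i\<^sup>+\<^sup>j)\<close>, so that its product over all integers \<open>j\<close>
  is the \<open>i\<close>-th term of \<open>F_xi\<close>, and its \<open>j\<close>-th projection is the canonical projection to
  \<open>F(X\<^sup>j, Y\<^sup>i\<^sup>+\<^sup>j)\<close>.
\<close>

definition F_fam ::
  "('o \<times> 'o', 'm \<times> 'm', 'p, 'n) func \<Rightarrow> ('o, 'm) cplx \<Rightarrow> ('o', 'm') cplx \<Rightarrow> int \<Rightarrow> int \<Rightarrow> 'p" where
  "F_fam F X Y i j = fobj F (term_at X j, term_at Y (i + j))"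

text \<open>
  With \<open>diff_at\<close> indexed by its source, the component at \<open>j\<close> of the differential from degree \<open>i\<close>
  to degree \<open>i + 1\<close> is the difference of \<open>F(X\<^sup>j, d\<^sub>Y)\<close> after the \<open>j\<close>-th projection and
  \<open>\<xi>\<^sup>i F(d\<^sub>X, Y\<^sup>i\<^sup>+\<^sup>1\<^sup>+\<^sup>j)\<close> after the \<open>(j+1)\<close>-st projection.  The exponent is an integer; \<open>\<xi>\<close> has to be
  a unit, as roots of unity are.
\<close>

definition F_diff_comp ::
  "('r, 'x) ring_scheme \<Rightarrow> ('o, 'm, 'z) cat_scheme \<Rightarrow> ('o', 'm', 'z') cat_scheme
     \<Rightarrow> ('p, 'n, 'r, 'y) lin_cat_scheme \<Rightarrow> ('o \<times> 'o', 'm \<times> 'm', 'p, 'n) func \<Rightarrow> 'r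
     \<Rightarrow> ('o, 'm) cplx \<Rightarrow> ('o', 'm') cplx \<Rightarrow> int \<Rightarrow> int \<Rightarrow> 'n" where
  "F_diff_comp R C C' D F \<xi> X Y i j =
    (let T = F_fam F X Y i;
         P = prod_obj D UNIV T;
         pr = prod_proj D UNIV T;
         Q = F_fam F X Y (i + 1) j;
         M = HomM D P Q;
         dY = fmor F (term_at X j, term_at Y (i + j)) (term_at X j, term_at Y (i + 1 + j))
                (Ident C (term_at X j), diff_at Y (i + j));
         dX = fmor F (term_at X (j + 1), term_at Y (i + 1 + j)) (term_at X j, term_at Y (i + 1 + j))
                (diff_at X j, Ident C' (term_at Y (i + 1 + j)))
     in Comp D P (T j) Q dY (pr j)
        \<ominus>\<^bsub>M\<^esub> (\<xi> [^]\<^bsub>R\<^esub> i) \<odot>\<^bsub>M\<^esub> Comp D P (T (j + 1)) Q dX (pr (j + 1)))"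

text \<open>
  On a pair of morphisms \<open>(f, g)\<close> the functor is \<open>\<Prod>\<^sub>j F(f\<^sup>j, g\<^sup>i\<^sup>+\<^sup>j)\<close>; taking \<open>g\<close> or \<open>f\<close> to be
  an identity gives its action in each variable separately.
\<close>

definition F_xi ::
  "('r, 'x) ring_scheme \<Rightarrow> ('o, 'm, 'z) cat_scheme \<Rightarrow> ('o', 'm', 'z') cat_scheme
     \<Rightarrow> ('p, 'n, 'r, 'y) lin_cat_scheme \<Rightarrow> ('o \<times> 'o', 'm \<times> 'm', 'p, 'n) func \<Rightarrow> 'r
     \<Rightarrow> (('o, 'm) cplx \<times> ('o', 'm') cplx, (int \<Rightarrow> 'm) \<times> (int \<Rightarrow> 'm'),
         ('p, 'n) cplx, int \<Rightarrow> 'n) func" where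
  "F_xi R C C' D F \<xi> = \<lparr>
     fobj = (\<lambda>(X, Y). \<lparr>
       term_at = (\<lambda>i. prod_obj D UNIV (F_fam F X Y i)),
       diff_at = (\<lambda>i. prod_tuple D UNIV (F_fam F X Y (i + 1)) (prod_obj D UNIV (F_fam F X Y i))
                        (F_diff_comp R C C' D F \<xi> X Y i))\<rparr>),
     fmor = (\<lambda>(X, Y) (X', Y') (f, g) i.
       prod_map D UNIV (F_fam F X Y i) (F_fam F X' Y' i)
         (\<lambda>j. fmor F (term_at X j, term_at Y (i + j)) (term_at X' j, term_at Y' (i + j))
                (f j, g (i + j))))\<rparr>"

end

theory Submission
  imports Defs "HOL-Library.Countable_Set"
begin

text \<open>
  \<open>F\<^sub>\<xi>(X, Y)\<close> is the product-total complex of the double complex \<open>K\<^sup>j\<^sup>,\<^sup>l = F(X\<^sup>j, Y\<^sup>l)\<close>, on which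
  \<open>d\<^sub>Y\<close> raises \<open>l\<close>, \<open>d\<^sub>X\<close> lowers \<open>j\<close>, and the two commute because \<open>F\<close> is a bifunctor.  That \<open>F\<^sub>\<xi>\<close> is a
  functor on \<open>\<infinity>\<close>-complexes can be checked after every projection, and there it is the functoriality
  and bilinearity of \<open>F\<close>.

  For \<open>N\<close>-complexes one has to expand the \<open>N\<close>-th power of the differential \<open>d\<close>.  In degree \<open>m\<close> it is
  \<open>d\<^sub>Y - \<xi>\<^sup>m d\<^sub>X\<close>, so starting in degree \<open>i\<close> the coefficient of \<open>d\<^sub>X\<^sup>s d\<^sub>Y\<^sup>n\<^sup>-\<^sup>s\<close> in \<open>d\<^sup>n\<close> is that of \<open>t\<^sup>s\<close> in
  \<open>\<Prod>m<n. (1 - w \<xi>\<^sup>m t)\<close> with \<open>w = \<xi>\<^sup>i\<close>; up to a factor it is a Gaussian binomial coefficient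
  (\<open>tot_proj_diff_pow\<close>).  For \<open>n = N\<close> the two outer terms vanish since \<open>d\<^sub>X\<^sup>N = 0\<close> and \<open>d\<^sub>Y\<^sup>N = 0\<close>.  The
  inner terms vanish for arithmetic reasons (\<open>twisted_Leibniz_coeff_vanish\<close>): if \<open>\<xi>\<close> is a primitive
  \<open>k\<close>-th root of unity in a domain, then the product over \<open>k\<close> consecutive factors is \<open>1 + u t\<^sup>k\<close>, and
  the product over \<open>p\<^sup>n k\<close> factors is \<open>(1 + u t\<^sup>k)\<close> to the power \<open>p\<^sup>n\<close>, whose inner coefficients are
  multiples of \<open>p\<close> and hence kill every morphism of \<open>D\<close>.  The three cases of the twisted Leibniz
  rule are \<open>k = 1\<close>, \<open>n = 0\<close> and the general one.
\<close>

section \<open>Coefficients of products of linear factors in geometric progression\<close>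

lemma (in abelian_group) minus_eq_zero_imp_eq:
  assumes "a \<in> carrier G" "b \<in> carrier G" "a \<ominus> b = \<zero>"
  shows "a = b"
  using assms minus_equality[of a "\<ominus> b"] by (simp add: a_minus_def)

context cring
begin

text \<open>
  The coefficient of \<open>t\<^sup>s\<close> in \<open>\<Prod>m<n. (1 - w x\<^sup>m t)\<close>.  Only the recursion in \<open>n\<close> matters, so the
  coefficients are defined by it, without the polynomial.
\<close>

primrec twisted_coeff :: "'a \<Rightarrow> 'a \<Rightarrow> nat \<Rightarrow> nat \<Rightarrow> 'a" where
  "twisted_coeff x w 0 s = (if s = 0 then \<one> else \<zero>)"
| "twisted_coeff x w (Suc n) s = twisted_coeff x w n s
     \<ominus> (case s of 0 \<Rightarrow> \<zero> | Suc t \<Rightarrow> w \<otimes> x [^] n \<otimes> twisted_coeff x w n t)"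

context
  fixes x w
  assumes x_closed [simp]: "x \<in> carrier R" and w_closed [simp]: "w \<in> carrier R"
begin

lemma twisted_coeff_closed [simp]: "twisted_coeff x w n s \<in> carrier R"
  by (induction n arbitrary: s) (auto split: nat.split)

lemma twisted_coeff_0_right [simp]: "twisted_coeff x w n 0 = \<one>"
  by (induction n) (auto simp: a_minus_def)

lemma twisted_coeff_eq_0: "n < s \<Longrightarrow> twisted_coeff x w n s = \<zero>"
  by (induction n arbitrary: s) (auto simp: a_minus_def split: nat.split)

text \<open>
  The analogue of \<open>(s + 1) (n choose (s + 1)) = (n - s) (n choose s)\<close> for Gaussian binomials, cleared
  of denominators.  Since it relates neighbouring coefficients of the same product, the vanishing
  of one of them propagates to the next.
\<close>

lemma twisted_coeff_ratio:
  "(\<one> \<ominus> x [^] Suc s) \<otimes> twisted_coeff x w n (Suc s) = w \<otimes> (x [^] n \<ominus> x [^] s) \<otimes> twisted_coeff x w n s"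
proof (induction n arbitrary: s)
  case 0
  show ?case by (cases s) (simp_all add: r_neg a_minus_def)
next
  case (Suc n)
  show ?case
  proof (cases s)
    case 0
    define a where "a = twisted_coeff x w n (Suc 0)"
    define Y where "Y = x [^] n"
    have [simp]: "a \<in> carrier R" "Y \<in> carrier R" by (simp_all add: a_def Y_def)
    have IH: "(\<one> \<ominus> x) \<otimes> a = w \<otimes> (Y \<ominus> \<one>)"
      using Suc.IH[of 0] by (simp add: a_def Y_def)
    have "(\<one> \<ominus> x) \<otimes> (a \<ominus> w \<otimes> Y) = (\<one> \<ominus> x) \<otimes> a \<ominus> (\<one> \<ominus> x) \<otimes> (w \<otimes> Y)"
      using x_closed w_closed \<open>a \<in> carrier R\<close> \<open>Y \<in> carrier R\<close> by algebra
    also have "\<dots> = w \<otimes> (Y \<otimes> x \<ominus> \<one>)"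
      unfolding IH using x_closed w_closed \<open>a \<in> carrier R\<close> \<open>Y \<in> carrier R\<close> by algebra
    finally show ?thesis by (simp add: 0 a_def Y_def a_minus_def)
  next
    case (Suc t)
    define a where "a = twisted_coeff x w n (Suc (Suc t))"
    define b where "b = twisted_coeff x w n (Suc t)"
    define e where "e = twisted_coeff x w n t"
    define X where "X = x [^] t"
    define Y where "Y = x [^] n"
    have cl: "a \<in> carrier R" "b \<in> carrier R" "e \<in> carrier R" "X \<in> carrier R" "Y \<in> carrier R"
      by (simp_all add: a_def b_def e_def X_def Y_def)
    have IH1: "(\<one> \<ominus> X \<otimes> x \<otimes> x) \<otimes> a = w \<otimes> (Y \<ominus> X \<otimes> x) \<otimes> b"
      using Suc.IH[of "Suc t"] by (simp add: a_def b_def X_def Y_def)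
    have IH2: "(\<one> \<ominus> X \<otimes> x) \<otimes> b = w \<otimes> (Y \<ominus> X) \<otimes> e"
      using Suc.IH[of t] by (simp add: b_def e_def X_def Y_def)
    have "(\<one> \<ominus> X \<otimes> x \<otimes> x) \<otimes> (a \<ominus> w \<otimes> Y \<otimes> b)
      = (\<one> \<ominus> X \<otimes> x \<otimes> x) \<otimes> a \<ominus> (\<one> \<ominus> X \<otimes> x \<otimes> x) \<otimes> (w \<otimes> Y \<otimes> b)"
      using x_closed w_closed cl by algebra
    also have "\<dots> = w \<otimes> x \<otimes> (Y \<ominus> X) \<otimes> b \<ominus> w \<otimes> Y \<otimes> x \<otimes> ((\<one> \<ominus> X \<otimes> x) \<otimes> b)"
      unfolding IH1 using x_closed w_closed cl by algebra
    also have "\<dots> = w \<otimes> (Y \<otimes> x \<ominus> X \<otimes> x) \<otimes> (b \<ominus> w \<otimes> Y \<otimes> e)"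
      unfolding IH2 using x_closed w_closed cl by algebra
    finally show ?thesis by (simp add: Suc a_def b_def e_def X_def Y_def)
  qed
qed

end

end

text \<open>
  For \<open>n = k\<close> the right-hand side of the ratio identity vanishes at \<open>s = 0\<close> because \<open>x\<^sup>k = 1\<close>.  The
  factor \<open>1 - x\<^sup>s\<^sup>+\<^sup>1\<close> on the left can be cancelled as long as \<open>s + 1 < k\<close>, so the coefficients of
  \<open>t, t\<^sup>2, \<dots>, t\<^sup>k\<^sup>-\<^sup>1\<close> vanish one after the other.
\<close>

lemma (in domain) twisted_coeff_primitive_root:
  assumes "primitive_root R k x" and "w \<in> carrier R" and "0 < s" and "s < k"
  shows "twisted_coeff x w k s = \<zero>"
proof -
  have x: "x \<in> carrier R" "x [^] k = \<one>"
    and ne: "\<And>j::nat. 0 < j \<Longrightarrow> j < k \<Longrightarrow> x [^] j \<noteq> \<one>"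
    using assms(1) by (auto simp: primitive_root_def)
  have "Suc s < k \<Longrightarrow> twisted_coeff x w k (Suc s) = \<zero>" for s
  proof (induction s)
    case 0
    have "(\<one> \<ominus> x [^] Suc 0) \<otimes> twisted_coeff x w k (Suc 0) = \<zero>"
      using twisted_coeff_ratio[OF x(1) assms(2), of 0 k] x assms(2)
      by (simp add: a_minus_def r_neg)
    moreover have "\<one> \<ominus> x [^] Suc 0 \<noteq> \<zero>"
      using ne[of "Suc 0"] 0 x(1) by (metis nat_pow_closed one_closed minus_eq_zero_imp_eq zero_less_Suc)
    ultimately show ?case
      using integral x assms(2) by (metis minus_closed nat_pow_closed one_closed twisted_coeff_closed)
  next
    case (Suc s)
    then have "twisted_coeff x w k (Suc s) = \<zero>" by simp
    then have "(\<one> \<ominus> x [^] Suc (Suc s)) \<otimes> twisted_coeff x w k (Suc (Suc s)) = \<zero>"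
      using twisted_coeff_ratio[OF x(1) assms(2), of "Suc s" k] x assms(2) by simp
    moreover have "\<one> \<ominus> x [^] Suc (Suc s) \<noteq> \<zero>"
      using ne[of "Suc (Suc s)"] Suc.prems x(1) by (metis nat_pow_closed one_closed minus_eq_zero_imp_eq zero_less_Suc)
    ultimately show ?case
      using integral x assms(2) by (metis minus_closed nat_pow_closed one_closed twisted_coeff_closed)
  qed
  from this[of "s - 1"] assms(3,4) show ?thesis by simp
qed

text \<open>
  By the previous lemma the first \<open>k\<close> factors multiply to \<open>1 + u t\<^sup>k\<close>; since \<open>x\<^sup>k = 1\<close>, the remaining
  \<open>a\<close> factors are the first \<open>a\<close> factors again.
\<close>

lemma (in domain) twisted_coeff_add_order:
  assumes "primitive_root R k x" and w: "w \<in> carrier R"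
  shows "twisted_coeff x w (a + k) s = twisted_coeff x w a s
    \<oplus> (if k \<le> s then twisted_coeff x w k k \<otimes> twisted_coeff x w a (s - k) else \<zero>)"
proof (induction a arbitrary: s)
  case 0
  have x: "x \<in> carrier R" "k > 0" using assms(1) by (auto simp: primitive_root_def)
  note [simp] = twisted_coeff_closed[OF x(1) w] 
  consider "s = 0" | "0 < s" "s < k" | "s = k" | "k < s" by linarith
  then show ?case
    by cases (use x w in \<open>simp_all add: twisted_coeff_primitive_root[OF assms] twisted_coeff_eq_0\<close>)
next
  case (Suc a)
  have x: "x \<in> carrier R" "k > 0" "x [^] k = \<one>" using assms(1) by (auto simp: primitive_root_def)
  have pow: "x [^] (a + k) = x [^] a"
    using x by (simp flip: nat_pow_mult)
  let ?u = "twisted_coeff x w k k" and ?c = "twisted_coeff x w a"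
  have cl: "twisted_coeff x w n r \<in> carrier R" "x [^] n \<in> carrier R" for n r :: nat
    using x w by simp_all
  show ?case
  proof (cases s)
    case 0
    with x w show ?thesis by simp
  next
    case (Suc t)
    have "Suc t < k \<or> k = Suc t \<or> k \<le> t" by linarith
    have step: "twisted_coeff x w (Suc a + k) (Suc t)
      = twisted_coeff x w (a + k) (Suc t) \<ominus> w \<otimes> x [^] a \<otimes> twisted_coeff x w (a + k) t"
      by (simp add: pow)
    have step': "twisted_coeff x w (Suc a) (Suc r) = ?c (Suc r) \<ominus> w \<otimes> x [^] a \<otimes> ?c r" for r
      by simp
    from \<open>Suc t < k \<or> k = Suc t \<or> k \<le> t\<close> show ?thesis
    proof (elim disjE)
      assume "Suc t < k"
      then show ?thesis unfolding Suc step step' Suc.IH using cl w by simp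
    next
      assume k: "k = Suc t"
      have "?c (Suc t) \<oplus> ?u \<otimes> \<one> \<ominus> w \<otimes> x [^] a \<otimes> (?c t \<oplus> \<zero>)
        = ?c (Suc t) \<ominus> w \<otimes> x [^] a \<otimes> ?c t \<oplus> ?u \<otimes> \<one>"
        using w cl(1)[of a t] cl(1)[of a "Suc t"] cl(1)[of k k] cl(2)[of a] by algebra
      moreover have "\<not> k \<le> t" "k \<le> Suc t" "Suc t - k = 0" using k by simp_all
      ultimately show ?thesis
        unfolding Suc step step' Suc.IH using twisted_coeff_0_right[OF x(1) w]
        by (simp only: if_True if_False)
    next
      assume "k \<le> t"
      then obtain r where "t = k + r" using le_Suc_ex by blast
      then have r: "k \<le> t" "k \<le> Suc t" "t - k = r" "Suc t - k = Suc r" by simp_all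
      have "?c (Suc t) \<oplus> ?u \<otimes> ?c (Suc r) \<ominus> w \<otimes> x [^] a \<otimes> (?c t \<oplus> ?u \<otimes> ?c r)
        = ?c (Suc t) \<ominus> w \<otimes> x [^] a \<otimes> ?c t \<oplus> ?u \<otimes> (?c (Suc r) \<ominus> w \<otimes> x [^] a \<otimes> ?c r)"
        using w cl(1)[of a t] cl(1)[of a "Suc t"] cl(1)[of a r] cl(1)[of a "Suc r"] cl(1)[of k k] cl(2)[of a]
        by algebra
      then show ?thesis
        unfolding Suc step step' Suc.IH r by (simp only: r if_True step')
    qed
  qed
qed

text \<open>
  Iterating gives the coefficients of \<open>(1 + u t\<^sup>k)\<^sup>m\<close>, by the Pascal recursion.
\<close>

lemma (in domain) twisted_coeff_mult_order:
  assumes "primitive_root R k x" and w: "w \<in> carrier R"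
  shows "twisted_coeff x w (m * k) s =
    (if k dvd s then [(m choose (s div k))] \<cdot>\<^bsub>R\<^esub> (twisted_coeff x w k k [^] (s div k)) else \<zero>)"
proof (induction m arbitrary: s)
  case 0
  have x: "x \<in> carrier R" "k > 0" using assms(1) by (auto simp: primitive_root_def)
  show ?case
  proof (cases "s = 0")
    case False
    have "0 < s div k" if "k dvd s"
      using that False x(2) by (simp add: div_greater_zero_iff dvd_imp_le)
    with False show ?thesis by (auto simp: binomial_eq_0)
  qed (use x w in simp)
next
  case (Suc m)
  have x: "x \<in> carrier R" "k > 0" using assms(1) by (auto simp: primitive_root_def)
  let ?u = "twisted_coeff x w k k"
  have u: "?u \<in> carrier R" using x w by simp
  have rec: "twisted_coeff x w (Suc m * k) s = twisted_coeff x w (m * k) s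
    \<oplus> (if k \<le> s then ?u \<otimes> twisted_coeff x w (m * k) (s - k) else \<zero>)"
    using twisted_coeff_add_order[OF assms, of "m * k" s] by (simp add: add.commute)
  show ?case
  proof (cases "k dvd s")
    case False
    then have "\<not> k dvd (s - k)" if "k \<le> s" using that by (simp add: dvd_minus_self)
    with False rec Suc.IH u show ?thesis by auto
  next
    case True
    then obtain j where j: "s = k * j" by blast
    show ?thesis
    proof (cases j)
      case 0
      with j x w show ?thesis by simp
    next
      case (Suc i)
      have "s - k = k * i" using j Suc by simp
      moreover have "k \<le> s" using j Suc by simp
      moreover have "[(m choose Suc i)] \<cdot>\<^bsub>R\<^esub> (?u [^] Suc i) \<oplus> ?u \<otimes> ([(m choose i)] \<cdot>\<^bsub>R\<^esub> (?u [^] i))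
        = [(Suc m choose Suc i)] \<cdot>\<^bsub>R\<^esub> (?u [^] Suc i)"
      proof -
        have "?u \<otimes> ([(m choose i)] \<cdot>\<^bsub>R\<^esub> (?u [^] i)) = [(m choose i)] \<cdot>\<^bsub>R\<^esub> (?u [^] Suc i)"
          using u by (simp add: add_pow_rdistr m_comm)
        moreover have "Suc m choose Suc i = (m choose Suc i) + (m choose i)" by simp
        ultimately show ?thesis
          using u add.nat_pow_mult[of "?u [^] Suc i" "m choose Suc i" "m choose i"]
          by (simp del: binomial_Suc_Suc nat_pow_Suc)
      qed
      ultimately show ?thesis using rec Suc.IH j Suc x by simp
    qed
  qed
qed

section \<open>Categories of complexes\<close>

lemma category_op_cat:
  assumes "category C"
  shows "category (op_cat C)"
proof -
  interpret category C by fact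
  show ?thesis
    by unfold_locales
      (auto simp: op_cat_def Ident_closed Comp_closed Comp_Ident_left Comp_Ident_right Comp_assoc)
qed

lemma category_prod_cat:
  assumes "category A" and "category B"
  shows "category (prod_cat A B)"
proof -
  interpret A: category A by fact
  interpret B: category B by fact
  show ?thesis
    by unfold_locales
      (auto simp: prod_cat_def
        A.Ident_closed A.Comp_closed A.Comp_Ident_left A.Comp_Ident_right A.Comp_assoc
        B.Ident_closed B.Comp_closed B.Comp_Ident_left B.Comp_Ident_right B.Comp_assoc)
qed

lemma category_full_subcat:
  assumes "category C"
  shows "category (full_subcat C P)"
proof -
  interpret category C by fact
  show ?thesis
    by unfold_locales
      (auto simp: full_subcat_def Ident_closed Comp_closed Comp_Ident_left Comp_Ident_right Comp_assoc)
qed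

lemma is_functor_full_subcat:
  assumes "is_functor A B F"
    and "category A'" and "Obj A' \<subseteq> Obj A" and "Hom A' = Hom A" and "Comp A' = Comp A" and "Ident A' = Ident A"
    and "\<And>X. X \<in> Obj A' \<Longrightarrow> P (fobj F X)"
  shows "is_functor A' (full_subcat B P) F"
proof -
  interpret is_functor A B F by fact
  have "category (full_subcat B P)" by (rule category_full_subcat) (rule B.category_axioms)
  then show ?thesis
    using assms(2-)
    by (auto intro!: is_functor.intro is_functor_axioms.intro
        simp: full_subcat_def subset_iff fobj_closed fmor_closed fmor_Ident fmor_Comp)
qed

context category
begin

lemma C_inf_term [simp]: "X \<in> Obj (C_inf C) \<Longrightarrow> term_at X i \<in> Obj C"
  and C_inf_diff: "X \<in> Obj (C_inf C) \<Longrightarrow> diff_at X i \<in> Hom C (term_at X i) (term_at X (i + 1))"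
  by (auto simp: C_inf_def)

lemma C_inf_hom_closed: "f \<in> Hom (C_inf C) X Y \<Longrightarrow> f i \<in> Hom C (term_at X i) (term_at Y i)"
  and C_inf_hom_diff: "f \<in> Hom (C_inf C) X Y \<Longrightarrow>
    Comp C (term_at X i) (term_at Y i) (term_at Y (i + 1)) (diff_at Y i) (f i)
       = Comp C (term_at X i) (term_at X (i + 1)) (term_at Y (i + 1)) (f (i + 1)) (diff_at X i)"
  unfolding C_inf_def cat.simps mem_Collect_eq by blast+

lemma C_inf_homI:
  assumes "\<And>i. f i \<in> Hom C (term_at X i) (term_at Y i)"
    and "\<And>i. Comp C (term_at X i) (term_at Y i) (term_at Y (i + 1)) (diff_at Y i) (f i)
       = Comp C (term_at X i) (term_at X (i + 1)) (term_at Y (i + 1)) (f (i + 1)) (diff_at X i)"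
  shows "f \<in> Hom (C_inf C) X Y"
  unfolding C_inf_def cat.simps mem_Collect_eq by (intro allI conjI assms)

lemma C_inf_Comp: "Comp (C_inf C) X Y Z g f = (\<lambda>i. Comp C (term_at X i) (term_at Y i) (term_at Z i) (g i) (f i))"
  and C_inf_Ident: "Ident (C_inf C) X = (\<lambda>i. Ident C (term_at X i))"
  by (simp_all only: C_inf_def cat.simps)

lemma category_C_inf: "category (C_inf C)"
proof
  fix X Y Z f g
  assume *: "X \<in> Obj (C_inf C)" "Y \<in> Obj (C_inf C)" "Z \<in> Obj (C_inf C)"
    "f \<in> Hom (C_inf C) X Y" "g \<in> Hom (C_inf C) Y Z"
  note t = *(1-3)[THEN C_inf_term] and d = *(1-3)[THEN C_inf_diff]
    and h = *(4,5)[THEN C_inf_hom_closed]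
  have "Comp C (term_at X i) (term_at Z i) (term_at Z (i + 1)) (diff_at Z i)
          (Comp C (term_at X i) (term_at Y i) (term_at Z i) (g i) (f i))
      = Comp C (term_at X i) (term_at X (i + 1)) (term_at Z (i + 1))
         (Comp C (term_at X (i + 1)) (term_at Y (i + 1)) (term_at Z (i + 1)) (g (i + 1)) (f (i + 1)))
         (diff_at X i)" for i
  proof -
    have "Comp C (term_at X i) (term_at Z i) (term_at Z (i + 1)) (diff_at Z i)
          (Comp C (term_at X i) (term_at Y i) (term_at Z i) (g i) (f i))
      = Comp C (term_at X i) (term_at Y i) (term_at Z (i + 1))
         (Comp C (term_at Y i) (term_at Z i) (term_at Z (i + 1)) (diff_at Z i) (g i)) (f i)"
      using t d h by (intro Comp_assoc)
    also have "\<dots> = Comp C (term_at X i) (term_at Y i) (term_at Z (i + 1))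
         (Comp C (term_at Y i) (term_at Y (i + 1)) (term_at Z (i + 1)) (g (i + 1)) (diff_at Y i)) (f i)"
      by (simp only: C_inf_hom_diff[OF *(5)])
    also have "\<dots> = Comp C (term_at X i) (term_at Y (i + 1)) (term_at Z (i + 1)) (g (i + 1))
         (Comp C (term_at X i) (term_at Y i) (term_at Y (i + 1)) (diff_at Y i) (f i))"
      using t d h by (intro Comp_assoc[symmetric])
    also have "\<dots> = Comp C (term_at X i) (term_at Y (i + 1)) (term_at Z (i + 1)) (g (i + 1))
         (Comp C (term_at X i) (term_at X (i + 1)) (term_at Y (i + 1)) (f (i + 1)) (diff_at X i))"
      by (simp only: C_inf_hom_diff[OF *(4)])
    also have "\<dots> = Comp C (term_at X i) (term_at X (i + 1)) (term_at Z (i + 1))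
         (Comp C (term_at X (i + 1)) (term_at Y (i + 1)) (term_at Z (i + 1)) (g (i + 1)) (f (i + 1)))
         (diff_at X i)"
      using t d h by (intro Comp_assoc)
    finally show ?thesis .
  qed
  then show "Comp (C_inf C) X Y Z g f \<in> Hom (C_inf C) X Z"
    unfolding C_inf_Comp using t h by (intro C_inf_homI) (auto intro: Comp_closed)
next
  fix X assume "X \<in> Obj (C_inf C)"
  then show "Ident (C_inf C) X \<in> Hom (C_inf C) X X"
    unfolding C_inf_Ident
    by (intro C_inf_homI) (simp_all add: C_inf_diff Ident_closed Comp_Ident_left Comp_Ident_right)
qed (simp_all add: C_inf_Comp C_inf_Ident C_inf_hom_closed Comp_Ident_left Comp_Ident_right Comp_assoc)

lemma diff_pow_closed:
  assumes "X \<in> Obj (C_inf C)"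
  shows "diff_pow C X n i \<in> Hom C (term_at X i) (term_at X (i + int n))"
proof (induction n)
  case 0
  then show ?case using assms by (simp add: Ident_closed)
next
  case (Suc n)
  have "i + int (Suc n) = i + int n + 1" by simp
  then show ?case using assms Suc C_inf_diff[OF assms, of "i + int n"] by (simp only: diff_pow.simps) (intro Comp_closed C_inf_term)
qed

text \<open>
  The iterated differential is defined by adding differentials at its target.  Since \<open>F\<close> is
  contravariant in \<open>X\<close>, a further \<open>d\<^sub>X\<close> in \<open>F(X, Y)\<close> is added at the source.
\<close>

lemma diff_pow_Suc_front:
  assumes "X \<in> Obj (C_inf C)"
  shows "diff_pow C X (Suc n) i = Comp C (term_at X i) (term_at X (i + 1)) (term_at X (i + 1 + int n))
    (diff_pow C X n (i + 1)) (diff_at X i)"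
proof (induction n)
  case 0
  then show ?case using assms C_inf_diff[OF assms, of i] by (simp add: Comp_Ident_left Comp_Ident_right)
next
  case (Suc n)
  have eq: "i + int (Suc n) = i + 1 + int n" "i + 1 + int (Suc n) = i + 1 + int n + 1" by simp_all
  have "diff_pow C X (Suc (Suc n)) i
    = Comp C (term_at X i) (term_at X (i + int (Suc n))) (term_at X (i + int (Suc n) + 1))
       (diff_at X (i + int (Suc n))) (diff_pow C X (Suc n) i)"
    by (rule diff_pow.simps(2))
  also have "\<dots> = Comp C (term_at X i) (term_at X (i + 1)) (term_at X (i + 1 + int n + 1))
    (Comp C (term_at X (i + 1)) (term_at X (i + 1 + int n)) (term_at X (i + 1 + int n + 1))
      (diff_at X (i + 1 + int n)) (diff_pow C X n (i + 1))) (diff_at X i)"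
    unfolding Suc.IH eq(1)
    by (rule Comp_assoc) (simp_all only: C_inf_term[OF assms] C_inf_diff[OF assms] diff_pow_closed[OF assms])
  finally show ?case unfolding eq(2) diff_pow.simps(2) .
qed

end

section \<open>Products\<close>

lemma is_productD_ex1:
  assumes "is_product C I X P pr" "A \<in> Obj C" "\<And>i. i \<in> I \<Longrightarrow> g i \<in> Hom C A (X i)"
  shows "\<exists>!h. h \<in> Hom C A P \<and> (\<forall>i\<in>I. Comp C A P (X i) (pr i) h = g i)"
  using assms unfolding is_product_def by blast

lemma is_product_ext:
  assumes "is_product C I X P pr" "category C" "A \<in> Obj C" "\<And>i. i \<in> I \<Longrightarrow> X i \<in> Obj C"
    and "h \<in> Hom C A P" "h' \<in> Hom C A P"
    and "\<And>i. i \<in> I \<Longrightarrow> Comp C A P (X i) (pr i) h = Comp C A P (X i) (pr i) h'"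
  shows "h = h'"
proof -
  interpret category C by fact
  have "P \<in> Obj C" "\<And>i. i \<in> I \<Longrightarrow> pr i \<in> Hom C P (X i)"
    using assms(1) by (auto simp: is_product_def)
  then have "\<exists>!k. k \<in> Hom C A P \<and> (\<forall>i\<in>I. Comp C A P (X i) (pr i) k = Comp C A P (X i) (pr i) h')"
    using assms by (intro is_productD_ex1) (auto intro: Comp_closed)
  then show ?thesis using assms(5-) by blast
qed

text \<open>
  Enumerating the index set turns the family into one indexed by natural numbers.
\<close>

lemma is_product_prod_obj:
  assumes C: "has_countable_products C" and I: "countable I" and X: "\<And>i. i \<in> I \<Longrightarrow> X i \<in> Obj C"
  shows "is_product C I X (prod_obj C I X) (prod_proj C I X)"
proof -
  define J where "J = to_nat_on I ` I"
  have inv: "from_nat_into I (to_nat_on I i) = i" if "i \<in> I" for i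
    using I that by simp
  have "\<forall>j\<in>J. X (from_nat_into I j) \<in> Obj C" using X inv by (auto simp: J_def)
  then obtain P pr where P: "is_product C J (\<lambda>j. X (from_nat_into I j)) P pr"
    using C[unfolded has_countable_products_def, THEN spec, THEN spec, of J "\<lambda>j. X (from_nat_into I j)"]
    by (elim impE exE) auto
  have "is_product C I X P (\<lambda>i. pr (to_nat_on I i))"
    unfolding is_product_def
  proof (intro conjI ballI allI impI)
    show "P \<in> Obj C" using P by (simp add: is_product_def)
  next
    fix i assume "i \<in> I"
    then show "pr (to_nat_on I i) \<in> Hom C P (X i)"
      using P inv[of i] by (auto simp: is_product_def J_def)
  next
    fix A g assume "A \<in> Obj C" "\<forall>i\<in>I. g i \<in> Hom C A (X i)"
    then have "\<exists>!h. h \<in> Hom C A P \<and>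
        (\<forall>j\<in>J. Comp C A P (X (from_nat_into I j)) (pr j) h = g (from_nat_into I j))"
      using inv by (intro is_productD_ex1[OF P]) (auto simp: J_def)
    then show "\<exists>!h. h \<in> Hom C A P \<and> (\<forall>i\<in>I. Comp C A P (X i) (pr (to_nat_on I i)) h = g i)"
      by (simp add: J_def inv)
  qed
  then have "\<exists>z. case z of (P, pr) \<Rightarrow> is_product C I X P pr" by auto
  then have "case chosen_product C I X of (P, pr) \<Rightarrow> is_product C I X P pr"
    unfolding chosen_product_def by (rule someI_ex)
  then show ?thesis by (simp add: prod_obj_def prod_proj_def split_beta)
qed

lemma prod_tuple:
  assumes P: "is_product C I X (prod_obj C I X) (prod_proj C I X)"
    and A: "A \<in> Obj C" "\<And>i. i \<in> I \<Longrightarrow> g i \<in> Hom C A (X i)"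
  shows prod_tuple_closed: "prod_tuple C I X A g \<in> Hom C A (prod_obj C I X)"
    and prod_proj_tuple: "i \<in> I \<Longrightarrow>
      Comp C A (prod_obj C I X) (X i) (prod_proj C I X i) (prod_tuple C I X A g) = g i"
  using theI'[OF is_productD_ex1[of C I X "prod_obj C I X" "prod_proj C I X" A g, OF P A]]
  unfolding prod_tuple_def by auto

section \<open>Linear categories\<close>

lemma linear_map_smult:
  "linear_map R M M' f \<Longrightarrow> a \<in> carrier R \<Longrightarrow> x \<in> carrier M \<Longrightarrow> f (a \<odot>\<^bsub>M\<^esub> x) = a \<odot>\<^bsub>M'\<^esub> f x"
  by (auto simp: linear_map_def)

lemma linear_map_zero:
  assumes "module R M" "module R M'" "linear_map R M M' f"
  shows "f \<zero>\<^bsub>M\<^esub> = \<zero>\<^bsub>M'\<^esub>"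
proof -
  interpret M: module R M by fact
  interpret M': module R M' by fact
  have "f \<zero>\<^bsub>M\<^esub> \<in> carrier M'"
    using assms(3) unfolding linear_map_def by auto
  then show ?thesis
    using linear_map_smult[OF assms(3) M.R.zero_closed M.M.zero_closed] by simp
qed

lemma linear_map_minus:
  assumes "module R M" "module R M'" "linear_map R M M' f" "x \<in> carrier M" "y \<in> carrier M"
  shows "f (x \<ominus>\<^bsub>M\<^esub> y) = f x \<ominus>\<^bsub>M'\<^esub> f y"
proof -
  interpret M: module R M by fact
  interpret M': module R M' by fact
  have f: "\<And>x. x \<in> carrier M \<Longrightarrow> f x \<in> carrier M'"
    "\<And>x y. x \<in> carrier M \<Longrightarrow> y \<in> carrier M \<Longrightarrow> f (x \<oplus>\<^bsub>M\<^esub> y) = f x \<oplus>\<^bsub>M'\<^esub> f y"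
    using assms(3) unfolding linear_map_def by auto
  have "f (\<ominus>\<^bsub>M\<^esub> y) \<oplus>\<^bsub>M'\<^esub> f y = \<zero>\<^bsub>M'\<^esub>"
    using f(2)[of "\<ominus>\<^bsub>M\<^esub> y" y] assms(5) linear_map_zero[OF assms(1-3)] by (simp add: M.l_neg)
  then have "\<ominus>\<^bsub>M'\<^esub> f y = f (\<ominus>\<^bsub>M\<^esub> y)"
    using assms(5) f(1) by (intro M'.minus_equality) simp_all
  then show ?thesis using f assms by (simp add: a_minus_def)
qed

lemma linear_map_finsum:
  assumes "module R M" "module R M'" "linear_map R M M' f" "finite A" "\<And>s. s \<in> A \<Longrightarrow> x s \<in> carrier M"
  shows "f (\<Oplus>\<^bsub>M\<^esub>s\<in>A. x s) = (\<Oplus>\<^bsub>M'\<^esub>s\<in>A. f (x s))"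
proof -
  interpret M: module R M by fact
  interpret M': module R M' by fact
  have f: "\<And>x. x \<in> carrier M \<Longrightarrow> f x \<in> carrier M'"
    "\<And>x y. x \<in> carrier M \<Longrightarrow> y \<in> carrier M \<Longrightarrow> f (x \<oplus>\<^bsub>M\<^esub> y) = f x \<oplus>\<^bsub>M'\<^esub> f y"
    using assms(3) unfolding linear_map_def by auto
  show ?thesis using assms(4,5)
  proof (induction A rule: finite_induct)
    case empty
    then show ?case by (simp add: linear_map_zero[OF assms(1-3)])
  next
    case (insert s A)
    then show ?case using f by (simp add: Pi_def M.M.finsum_closed)
  qed
qed

context linear_category
begin

lemma zero_closed:
  assumes "X \<in> Obj C" "Y \<in> Obj C"
  shows "\<zero>\<^bsub>HomM C X Y\<^esub> \<in> Hom C X Y"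
proof -
  interpret module R "HomM C X Y" by (rule HomM_module[OF assms])
  show ?thesis using M.zero_closed by (simp add: carrier_HomM assms)
qed

context
  fixes X Y Z
  assumes X: "X \<in> Obj C" and Y: "Y \<in> Obj C" and Z: "Z \<in> Obj C"
begin

lemma Comp_zero_right: "g \<in> Hom C Y Z \<Longrightarrow> Comp C X Y Z g \<zero>\<^bsub>HomM C X Y\<^esub> = \<zero>\<^bsub>HomM C X Z\<^esub>"
  using linear_map_zero[OF HomM_module[OF X Y] HomM_module[OF X Z] Comp_linear_right[OF X Y Z]] .

lemma Comp_zero_left: "f \<in> Hom C X Y \<Longrightarrow> Comp C X Y Z \<zero>\<^bsub>HomM C Y Z\<^esub> f = \<zero>\<^bsub>HomM C X Z\<^esub>"
  using linear_map_zero[OF HomM_module[OF Y Z] HomM_module[OF X Z] Comp_linear_left[OF X Y Z]] .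

lemma Comp_minus_left: "\<lbrakk>f \<in> Hom C X Y; g \<in> Hom C Y Z; g' \<in> Hom C Y Z\<rbrakk> \<Longrightarrow>
    Comp C X Y Z (g \<ominus>\<^bsub>HomM C Y Z\<^esub> g') f = Comp C X Y Z g f \<ominus>\<^bsub>HomM C X Z\<^esub> Comp C X Y Z g' f"
  using linear_map_minus[OF HomM_module[OF Y Z] HomM_module[OF X Z] Comp_linear_left[OF X Y Z]]
  by (simp add: carrier_HomM X Y Z)

lemma Comp_minus_right: "\<lbrakk>g \<in> Hom C Y Z; f \<in> Hom C X Y; f' \<in> Hom C X Y\<rbrakk> \<Longrightarrow>
    Comp C X Y Z g (f \<ominus>\<^bsub>HomM C X Y\<^esub> f') = Comp C X Y Z g f \<ominus>\<^bsub>HomM C X Z\<^esub> Comp C X Y Z g f'"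
  using linear_map_minus[OF HomM_module[OF X Y] HomM_module[OF X Z] Comp_linear_right[OF X Y Z]]
  by (simp add: carrier_HomM X Y Z)

lemma Comp_smult_left: "\<lbrakk>a \<in> carrier R; f \<in> Hom C X Y; g \<in> Hom C Y Z\<rbrakk> \<Longrightarrow>
    Comp C X Y Z (a \<odot>\<^bsub>HomM C Y Z\<^esub> g) f = a \<odot>\<^bsub>HomM C X Z\<^esub> Comp C X Y Z g f"
  using linear_map_smult[OF Comp_linear_left[OF X Y Z]] by (simp add: carrier_HomM X Y Z)

lemma Comp_smult_right: "\<lbrakk>a \<in> carrier R; g \<in> Hom C Y Z; f \<in> Hom C X Y\<rbrakk> \<Longrightarrow>
    Comp C X Y Z g (a \<odot>\<^bsub>HomM C X Y\<^esub> f) = a \<odot>\<^bsub>HomM C X Z\<^esub> Comp C X Y Z g f"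
  using linear_map_smult[OF Comp_linear_right[OF X Y Z]] by (simp add: carrier_HomM X Y Z)

lemma Comp_finsum_right: "\<lbrakk>g \<in> Hom C Y Z; finite A; \<And>s. s \<in> A \<Longrightarrow> f s \<in> Hom C X Y\<rbrakk> \<Longrightarrow>
    Comp C X Y Z g (\<Oplus>\<^bsub>HomM C X Y\<^esub>s\<in>A. f s) = (\<Oplus>\<^bsub>HomM C X Z\<^esub>s\<in>A. Comp C X Y Z g (f s))"
  by (rule linear_map_finsum[OF HomM_module[OF X Y] HomM_module[OF X Z] Comp_linear_right[OF X Y Z]])
    (simp_all add: carrier_HomM X Y)

lemma Comp_lincomb_right:
  assumes g: "g \<in> Hom C Y Z" and "finite A"
    and a: "\<And>s. s \<in> A \<Longrightarrow> a s \<in> carrier R" and f: "\<And>s. s \<in> A \<Longrightarrow> f s \<in> Hom C X Y"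
  shows "Comp C X Y Z g (\<Oplus>\<^bsub>HomM C X Y\<^esub>s\<in>A. a s \<odot>\<^bsub>HomM C X Y\<^esub> f s)
    = (\<Oplus>\<^bsub>HomM C X Z\<^esub>s\<in>A. a s \<odot>\<^bsub>HomM C X Z\<^esub> Comp C X Y Z g (f s))"
proof -
  interpret XY: module R "HomM C X Y" by (rule HomM_module[OF X Y])
  interpret XZ: module R "HomM C X Z" by (rule HomM_module[OF X Z])
  have af: "a s \<odot>\<^bsub>HomM C X Y\<^esub> f s \<in> Hom C X Y" if "s \<in> A" for s
    using a[OF that] f[OF that] unfolding carrier_HomM[OF X Y, symmetric] by simp
  have agf: "a s \<odot>\<^bsub>HomM C X Z\<^esub> Comp C X Y Z g (f s) \<in> carrier (HomM C X Z)" if "s \<in> A" for s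
    using a[OF that] Comp_closed[OF X Y Z f[OF that] g]
    unfolding carrier_HomM[OF X Z, symmetric] by simp
  have "Comp C X Y Z g (\<Oplus>\<^bsub>HomM C X Y\<^esub>s\<in>A. a s \<odot>\<^bsub>HomM C X Y\<^esub> f s)
    = (\<Oplus>\<^bsub>HomM C X Z\<^esub>s\<in>A. Comp C X Y Z g (a s \<odot>\<^bsub>HomM C X Y\<^esub> f s))"
    by (rule Comp_finsum_right[OF g \<open>finite A\<close> af])
  also have "\<dots> = (\<Oplus>\<^bsub>HomM C X Z\<^esub>s\<in>A. a s \<odot>\<^bsub>HomM C X Z\<^esub> Comp C X Y Z g (f s))"
    using agf by (intro XZ.M.finsum_cong') (auto simp: Comp_smult_right a f g)
  finally show ?thesis .
qed

end

end

text \<open>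
  Hom-modules into and out of a zero object have a single element, their zero, so factoring through
  such an object is the same as being zero in the hom-module.
\<close>

lemma (in additive_category) zero_morphism_iff:
  assumes X: "X \<in> Obj C" and Y: "Y \<in> Obj C"
  shows "zero_morphism C X Y f \<longleftrightarrow> f = \<zero>\<^bsub>HomM C X Y\<^esub>"
proof
  note zero = zero_closed
  {
    assume "zero_morphism C X Y f"
    then obtain Z g h where Z: "zero_object C Z" and gh: "g \<in> Hom C X Z" "h \<in> Hom C Z Y" "f = Comp C X Z Y h g"
      unfolding zero_morphism_def by blast
    then have "Z \<in> Obj C" "g = \<zero>\<^bsub>HomM C X Z\<^esub>"
      using X zero unfolding zero_object_def by blast+
    then show "f = \<zero>\<^bsub>HomM C X Y\<^esub>"
      using gh X Y Comp_zero_right by simp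
  next
    assume f: "f = \<zero>\<^bsub>HomM C X Y\<^esub>"
    obtain Z where Z: "zero_object C Z" "Z \<in> Obj C"
      using ex_zero_object unfolding zero_object_def by blast
    then have "f = Comp C X Z Y \<zero>\<^bsub>HomM C Z Y\<^esub> \<zero>\<^bsub>HomM C X Z\<^esub>"
      using f X Y zero Comp_zero_right by simp
    then show "zero_morphism C X Y f"
      unfolding zero_morphism_def using Z zero X Y by blast
  }
qed

section \<open>Vanishing of the inner coefficients\<close>

lemma prime_dvd_prime_power_choose:
  fixes p :: nat
  assumes "prime p" and "0 < j" and "j < p ^ n"
  shows "p dvd (p ^ n choose j)"
proof -
  have "j * (p ^ n choose j) = p ^ n * (p ^ n - 1 choose (j - 1))"
    using assms(2,3) times_binomial_minus1_eq[of j "p ^ n"] by simp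
  then have "p ^ n dvd j * (p ^ n choose j)" by simp
  show ?thesis
  proof (rule ccontr)
    assume "\<not> p dvd (p ^ n choose j)"
    then have "coprime (p ^ n) (p ^ n choose j)"
      using assms(1) by (simp add: coprime_power_left_iff prime_imp_coprime)
    with \<open>p ^ n dvd j * (p ^ n choose j)\<close> have "p ^ n dvd j"
      using coprime_dvd_mult_left_iff by blast
    with assms(2,3) show False by (simp add: nat_dvd_not_less)
  qed
qed

lemma (in module) smult_add_pow:
  fixes n :: nat
  assumes a: "a \<in> carrier R" and f: "f \<in> carrier M"
  shows "([n] \<cdot>\<^bsub>R\<^esub> a) \<odot>\<^bsub>M\<^esub> f = [n] \<cdot>\<^bsub>M\<^esub> (a \<odot>\<^bsub>M\<^esub> f)"
  by (induction n) (use a f in \<open>simp_all add: smult_l_distr\<close>)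

text \<open>
  All three cases have the shape \<open>N = p\<^sup>n k\<close> with \<open>\<xi>\<close> a primitive \<open>k\<close>-th root of unity: the coefficient
  is zero in \<open>R\<close> unless \<open>s = k j\<close>, and then it contains the factor \<open>p\<^sup>n choose j\<close>, a multiple of \<open>p\<close>.
  As \<open>R\<close> itself may have characteristic \<open>0\<close>, this coefficient need not be zero; it only acts as zero
  on the morphisms of \<open>D\<close>.
\<close>

lemma twisted_Leibniz_coeff_vanish:
  assumes "domain R" and "linear_category R D" and L: "allows_twisted_Leibniz R D N \<xi>"
    and w: "w \<in> carrier R" and A: "A \<in> Obj D" and B: "B \<in> Obj D" and f: "f \<in> Hom D A B"
    and s: "0 < s" "s < N"
  shows "cring.twisted_coeff R \<xi> w N s \<odot>\<^bsub>HomM D A B\<^esub> f = \<zero>\<^bsub>HomM D A B\<^esub>"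
proof -
  interpret R: domain R by fact
  interpret D: linear_category R D by fact
  interpret M: module R "HomM D A B" by (rule D.HomM_module[OF A B])
  note car = D.carrier_HomM[OF A B]
  have p: ?thesis if asm: "prime p" "killed_by p D" "primitive_root R k \<xi>" "N = p ^ n * k" for p n k
  proof (cases "k dvd s")
    case False
    then show ?thesis
      using R.twisted_coeff_mult_order[OF asm(3) w, of "p ^ n" s] f car asm(4) by simp
  next
    case True
    then obtain j where j: "s = k * j" by blast
    let ?u = "R.twisted_coeff \<xi> w k k"
    have xi: "\<xi> \<in> carrier R" "0 < k" using asm(3) by (auto simp: primitive_root_def)
    have u: "?u \<in> carrier R" using xi w by simp
    have "0 < j" "j < p ^ n" using s j asm(4) by (auto simp: mult.commute)
    then obtain q where q: "p ^ n choose j = p * q"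
      using prime_dvd_prime_power_choose[OF asm(1)] by blast
    have "R.twisted_coeff \<xi> w N s = [(p * q)] \<cdot>\<^bsub>R\<^esub> (?u [^]\<^bsub>R\<^esub> j)"
      using R.twisted_coeff_mult_order[OF asm(3) w, of "p ^ n" s] xi(2) by (simp add: asm(4) j q)
    also have "\<dots> = [p] \<cdot>\<^bsub>R\<^esub> ([q] \<cdot>\<^bsub>R\<^esub> (?u [^]\<^bsub>R\<^esub> j))"
      using u by (simp add: R.add.nat_pow_pow mult.commute)
    finally have "R.twisted_coeff \<xi> w N s \<odot>\<^bsub>HomM D A B\<^esub> f
      = [p] \<cdot>\<^bsub>HomM D A B\<^esub> (([q] \<cdot>\<^bsub>R\<^esub> (?u [^]\<^bsub>R\<^esub> j)) \<odot>\<^bsub>HomM D A B\<^esub> f)"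
      using u f car by (simp add: M.smult_add_pow)
    moreover have "([q] \<cdot>\<^bsub>R\<^esub> (?u [^]\<^bsub>R\<^esub> j)) \<odot>\<^bsub>HomM D A B\<^esub> f \<in> Hom D A B"
      using u f unfolding car[symmetric] by simp
    ultimately show ?thesis using asm(2) A B unfolding killed_by_def by simp
  qed
  from L consider p n where "prime p" "killed_by p D" "\<xi> = \<one>\<^bsub>R\<^esub>" "N = p ^ n"
    | "primitive_root R N \<xi>"
    | p n k where "prime p" "killed_by p D" "primitive_root R k \<xi>" "N = p ^ n * k"
    unfolding allows_twisted_Leibniz_def by blast
  then show ?thesis
  proof cases
    case 1
    then have "primitive_root R 1 \<xi>" by (auto simp: primitive_root_def)
    then show ?thesis using p[of p 1 n] 1 by simp
  next
    case 2
    then show ?thesis using R.twisted_coeff_primitive_root[OF 2 w s] f car by simp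
  next
    case 3
    then show ?thesis by (rule p)
  qed
qed

section \<open>The total complex of a bifunctor\<close>

text \<open>
  The units form a group, so integer powers of a unit obey the laws of powers in a group.
\<close>

lemma (in monoid) Units_int_pow_units_of:
  "a \<in> Units G \<Longrightarrow> a [^]\<^bsub>G\<^esub> (z::int) = a [^]\<^bsub>units_of G\<^esub> z"
proof -
  assume a: "a \<in> Units G"
  have pow: "a [^]\<^bsub>G\<^esub> n = a [^]\<^bsub>units_of G\<^esub> n" for n :: nat
    by (simp add: nat_pow_def units_of_mult units_of_one)
  have "a [^]\<^bsub>units_of G\<^esub> n \<in> Units G" for n :: nat
    using monoid.nat_pow_closed[OF group.is_monoid[OF units_group], of a n] a
    by (simp add: units_of_carrier)
  then have inv: "inv (a [^]\<^bsub>units_of G\<^esub> n) = inv\<^bsub>units_of G\<^esub> (a [^]\<^bsub>units_of G\<^esub> n)" for n :: nat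
    using units_of_inv by simp
  show ?thesis unfolding int_pow_def2 pow inv ..
qed

lemma (in monoid) Units_int_pow_closed:
  assumes "a \<in> Units G"
  shows "a [^] (z::int) \<in> carrier G"
  using assms group.int_pow_closed[OF units_group, of a z]
  by (simp add: Units_int_pow_units_of units_of_carrier Units_closed)

lemma (in monoid) Units_int_pow_add_nat:
  assumes "a \<in> Units G"
  shows "a [^] (z + int n) = a [^] z \<otimes> a [^] n"
proof -
  have "a [^] (z + int n) = a [^] z \<otimes> a [^] (int n)"
    using assms group.int_pow_mult[OF units_group, of a z "int n"]
    by (simp add: Units_int_pow_units_of units_of_carrier units_of_mult)
  then show ?thesis by (simp add: int_pow_int)
qed

lemma (in cring) primitive_root_Units:
  assumes "primitive_root R k x"
  shows "x \<in> Units R"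
proof -
  obtain m where "k = Suc m" using assms by (auto simp: primitive_root_def gr0_conv_Suc)
  then have "x [^] m \<otimes> x = \<one>" "x \<in> carrier R" using assms by (auto simp: primitive_root_def)
  then show ?thesis unfolding Units_def using m_comm[of x "x [^] m"] by (auto intro!: bexI[of _ "x [^] m"])
qed

text \<open>
  The recursion of the coefficients, summed against a family \<open>e\<close>.  In the expansion of \<open>d\<^sup>n\<^sup>+\<^sup>1\<close> the first
  sum is \<open>d\<^sub>Y\<close> applied to the expansion of \<open>d\<^sup>n\<close> and the second is \<open>d\<^sub>X\<close> applied to it.
\<close>

lemma (in module) twisted_sum_Suc:
  assumes x: "x \<in> carrier R" and w: "w \<in> carrier R" and e: "\<And>s. s \<le> Suc n \<Longrightarrow> e s \<in> carrier M"
  shows "(\<Oplus>\<^bsub>M\<^esub>s\<in>{..Suc n}. twisted_coeff x w (Suc n) s \<odot>\<^bsub>M\<^esub> e s)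
    = (\<Oplus>\<^bsub>M\<^esub>s\<in>{..n}. twisted_coeff x w n s \<odot>\<^bsub>M\<^esub> e s)
      \<ominus>\<^bsub>M\<^esub> (w \<otimes> x [^] n) \<odot>\<^bsub>M\<^esub> (\<Oplus>\<^bsub>M\<^esub>s\<in>{..n}. twisted_coeff x w n s \<odot>\<^bsub>M\<^esub> e (Suc s))"
proof -
  let ?c = "twisted_coeff x w n" and ?v = "w \<otimes> x [^] n"
  note cl = twisted_coeff_closed[OF x w]
  have v: "?v \<in> carrier R" using x w by simp
  have e': "e s \<in> carrier M" if "s \<in> {..n}" for s using e that by simp
  have e'': "e (Suc s) \<in> carrier M" if "s \<in> {..n}" for s using e that by simp
  have "(\<Oplus>\<^bsub>M\<^esub>s\<in>{..Suc n}. twisted_coeff x w (Suc n) s \<odot>\<^bsub>M\<^esub> e s)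
    = (\<Oplus>\<^bsub>M\<^esub>s\<in>{..n}. twisted_coeff x w (Suc n) (Suc s) \<odot>\<^bsub>M\<^esub> e (Suc s)) \<oplus>\<^bsub>M\<^esub> twisted_coeff x w (Suc n) 0 \<odot>\<^bsub>M\<^esub> e 0"
    using e cl[of "Suc n"] by (intro M.finsum_Suc2) auto
  also have "(\<Oplus>\<^bsub>M\<^esub>s\<in>{..n}. twisted_coeff x w (Suc n) (Suc s) \<odot>\<^bsub>M\<^esub> e (Suc s))
    = (\<Oplus>\<^bsub>M\<^esub>s\<in>{..n}. ?c (Suc s) \<odot>\<^bsub>M\<^esub> e (Suc s) \<oplus>\<^bsub>M\<^esub> (\<ominus> ?v) \<odot>\<^bsub>M\<^esub> (?c s \<odot>\<^bsub>M\<^esub> e (Suc s)))"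
  proof (rule M.finsum_cong')
    fix s assume "s \<in> {..n}"
    have "twisted_coeff x w (Suc n) (Suc s) = ?c (Suc s) \<oplus> (\<ominus> ?v) \<otimes> ?c s"
      using cl v by (simp add: a_minus_def l_minus)
    then show "twisted_coeff x w (Suc n) (Suc s) \<odot>\<^bsub>M\<^esub> e (Suc s)
      = ?c (Suc s) \<odot>\<^bsub>M\<^esub> e (Suc s) \<oplus>\<^bsub>M\<^esub> (\<ominus> ?v) \<odot>\<^bsub>M\<^esub> (?c s \<odot>\<^bsub>M\<^esub> e (Suc s))"
      using cl v e''[OF \<open>s \<in> {..n}\<close>]
      by (simp only: smult_l_distr smult_assoc1 R.m_closed R.a_inv_closed)
  qed (use e'' cl v in auto)
  also have "\<dots> = (\<Oplus>\<^bsub>M\<^esub>s\<in>{..n}. ?c (Suc s) \<odot>\<^bsub>M\<^esub> e (Suc s))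
      \<oplus>\<^bsub>M\<^esub> (\<Oplus>\<^bsub>M\<^esub>s\<in>{..n}. (\<ominus> ?v) \<odot>\<^bsub>M\<^esub> (?c s \<odot>\<^bsub>M\<^esub> e (Suc s)))"
    using e'' cl v by (intro M.finsum_addf) auto
  also have "(\<Oplus>\<^bsub>M\<^esub>s\<in>{..n}. (\<ominus> ?v) \<odot>\<^bsub>M\<^esub> (?c s \<odot>\<^bsub>M\<^esub> e (Suc s)))
      = (\<ominus> ?v) \<odot>\<^bsub>M\<^esub> (\<Oplus>\<^bsub>M\<^esub>s\<in>{..n}. ?c s \<odot>\<^bsub>M\<^esub> e (Suc s))"
    using e'' cl v by (intro finsum_smult_ldistr[symmetric]) auto
  also have "\<dots> = \<ominus>\<^bsub>M\<^esub> (?v \<odot>\<^bsub>M\<^esub> (\<Oplus>\<^bsub>M\<^esub>s\<in>{..n}. ?c s \<odot>\<^bsub>M\<^esub> e (Suc s)))"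
    using e'' cl v by (intro smult_l_minus M.finsum_closed) auto
  also have "twisted_coeff x w (Suc n) 0 = ?c 0"
    using twisted_coeff_0_right[OF x w] by (simp only:)
  also have "(\<Oplus>\<^bsub>M\<^esub>s\<in>{..n}. ?c (Suc s) \<odot>\<^bsub>M\<^esub> e (Suc s)) \<oplus>\<^bsub>M\<^esub>
      \<ominus>\<^bsub>M\<^esub> (?v \<odot>\<^bsub>M\<^esub> (\<Oplus>\<^bsub>M\<^esub>s\<in>{..n}. ?c s \<odot>\<^bsub>M\<^esub> e (Suc s))) \<oplus>\<^bsub>M\<^esub> ?c 0 \<odot>\<^bsub>M\<^esub> e 0
    = ((\<Oplus>\<^bsub>M\<^esub>s\<in>{..n}. ?c (Suc s) \<odot>\<^bsub>M\<^esub> e (Suc s)) \<oplus>\<^bsub>M\<^esub> ?c 0 \<odot>\<^bsub>M\<^esub> e 0)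
      \<ominus>\<^bsub>M\<^esub> ?v \<odot>\<^bsub>M\<^esub> (\<Oplus>\<^bsub>M\<^esub>s\<in>{..n}. ?c s \<odot>\<^bsub>M\<^esub> e (Suc s))"
  proof -
    have "a \<oplus>\<^bsub>M\<^esub> \<ominus>\<^bsub>M\<^esub> b \<oplus>\<^bsub>M\<^esub> c = a \<oplus>\<^bsub>M\<^esub> c \<ominus>\<^bsub>M\<^esub> b"
      if "a \<in> carrier M" "b \<in> carrier M" "c \<in> carrier M" for a b c
      using that by (simp add: a_minus_def M.a_ac)
    then show ?thesis
      using e'' e'[of 0] cl v by (auto intro!: M.finsum_closed)
  qed
  also have "(\<Oplus>\<^bsub>M\<^esub>s\<in>{..n}. ?c (Suc s) \<odot>\<^bsub>M\<^esub> e (Suc s)) \<oplus>\<^bsub>M\<^esub> ?c 0 \<odot>\<^bsub>M\<^esub> e 0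
    = (\<Oplus>\<^bsub>M\<^esub>s\<in>{..Suc n}. ?c s \<odot>\<^bsub>M\<^esub> e s)"
    using e cl by (intro M.finsum_Suc2[symmetric]) auto
  \<comment> \<open>The new top summand does not count: the product of \<open>n\<close> factors has degree \<open>n\<close>.\<close>
  also have "\<dots> = ?c (Suc n) \<odot>\<^bsub>M\<^esub> e (Suc n) \<oplus>\<^bsub>M\<^esub> (\<Oplus>\<^bsub>M\<^esub>s\<in>{..n}. ?c s \<odot>\<^bsub>M\<^esub> e s)"
    using e cl by (intro M.finsum_Suc) auto
  also have "\<dots> = (\<Oplus>\<^bsub>M\<^esub>s\<in>{..n}. ?c s \<odot>\<^bsub>M\<^esub> e s)"
    using e e' cl x w by (simp add: twisted_coeff_eq_0 M.finsum_closed)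
  finally show ?thesis .
qed

text \<open>
  Complexes extend to negative degrees \<open>i\<close>; requiring \<open>\<xi>\<close> to be a unit gives the twist \<open>\<xi>\<^sup>i\<close> the
  laws of powers there as well.
\<close>

locale twisted_bifunctor =
  C: additive_category R C + C': additive_category R C' + D: additive_category R D +
  linear_bifunctor R C C' D F
  for R :: "('r, 'x) ring_scheme" and C :: "('o, 'm, 'r, 'z) lin_cat_scheme"
    and C' :: "('o', 'm', 'r, 'z') lin_cat_scheme" and D :: "('p, 'n, 'r, 'y) lin_cat_scheme"
    and F :: "('o \<times> 'o', 'm \<times> 'm', 'p, 'n) func" +
  fixes \<xi> :: 'r
  assumes D_products: "has_countable_products D" and xi_unit: "\<xi> \<in> Units R"
begin

text \<open>
  Being a module over \<open>R\<close> includes that \<open>R\<close> is a commutative ring, and the zero object provides a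
  hom-module.
\<close>

lemma cring_R: "cring R"
proof -
  obtain Z where "Z \<in> Obj D" using D.ex_zero_object by (auto simp: zero_object_def)
  then show ?thesis using D.HomM_module module_def by blast
qed

sublocale R: cring R by (rule cring_R)

lemma F_obj_closed: "X \<in> Obj C \<Longrightarrow> Y \<in> Obj C' \<Longrightarrow> fobj F (X, Y) \<in> Obj D"
  using fobj_closed[of "(X, Y)"] by (simp add: prod_cat_def op_cat_def)

lemma F_mor_closed:
  "\<lbrakk>X \<in> Obj C; X' \<in> Obj C; Y \<in> Obj C'; Y' \<in> Obj C'; f \<in> Hom C X' X; g \<in> Hom C' Y Y'\<rbrakk>
    \<Longrightarrow> fmor F (X, Y) (X', Y') (f, g) \<in> Hom D (fobj F (X, Y)) (fobj F (X', Y'))"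
  using fmor_closed[of "(X, Y)" "(X', Y')" "(f, g)"] by (simp add: prod_cat_def op_cat_def)

lemma F_mor_Ident:
  "X \<in> Obj C \<Longrightarrow> Y \<in> Obj C' \<Longrightarrow>
    fmor F (X, Y) (X, Y) (Ident C X, Ident C' Y) = Ident D (fobj F (X, Y))"
  using fmor_Ident[of "(X, Y)"] by (simp add: prod_cat_def op_cat_def)

lemma F_mor_Comp:
  "\<lbrakk>X \<in> Obj C; X' \<in> Obj C; X'' \<in> Obj C; Y \<in> Obj C'; Y' \<in> Obj C'; Y'' \<in> Obj C';
    f \<in> Hom C X' X; g \<in> Hom C' Y Y'; f' \<in> Hom C X'' X'; g' \<in> Hom C' Y' Y''\<rbrakk>
    \<Longrightarrow> Comp D (fobj F (X, Y)) (fobj F (X', Y')) (fobj F (X'', Y''))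
        (fmor F (X', Y') (X'', Y'') (f', g')) (fmor F (X, Y) (X', Y') (f, g))
      = fmor F (X, Y) (X'', Y'') (Comp C X'' X' X f f', Comp C' Y Y' Y'' g' g)"
  using fmor_Comp[of "(X, Y)" "(X', Y')" "(X'', Y'')" "(f, g)" "(f', g')"]
  by (simp add: prod_cat_def op_cat_def)

lemma F_mor_zero_first:
  assumes "X \<in> Obj C" "X' \<in> Obj C" "Y \<in> Obj C'" "Y' \<in> Obj C'" "g \<in> Hom C' Y Y'"
  shows "fmor F (X, Y) (X', Y') (\<zero>\<^bsub>HomM C X' X\<^esub>, g) = \<zero>\<^bsub>HomM D (fobj F (X, Y)) (fobj F (X', Y'))\<^esub>"
  using linear_map_zero[OF C.HomM_module D.HomM_module linear_first] F_obj_closed assms by blast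

lemma F_mor_zero_second:
  assumes "X \<in> Obj C" "X' \<in> Obj C" "Y \<in> Obj C'" "Y' \<in> Obj C'" "f \<in> Hom C X' X"
  shows "fmor F (X, Y) (X', Y') (f, \<zero>\<^bsub>HomM C' Y Y'\<^esub>) = \<zero>\<^bsub>HomM D (fobj F (X, Y)) (fobj F (X', Y'))\<^esub>"
  using linear_map_zero[OF C'.HomM_module D.HomM_module linear_second] F_obj_closed assms by blast

text \<open>
  The data of the total complex of \<open>K\<^sup>j\<^sup>,\<^sup>l = F(X\<^sup>j, Y\<^sup>l)\<close>; its entries in total degree \<open>i\<close> are
  \<open>K\<^sup>j\<^sup>,\<^sup>i\<^sup>+\<^sup>j\<close>, written \<open>F_fam F X Y i j\<close>.  Both \<open>F_diff_Y X Y i j\<close> and \<open>F_diff_X X Y i j\<close> end in the \<open>j\<close>-th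
  entry of degree \<open>i + 1\<close>.
\<close>

abbreviation tot_obj where "tot_obj X Y i \<equiv> prod_obj D UNIV (F_fam F X Y i)"
abbreviation tot_proj where "tot_proj X Y i \<equiv> prod_proj D UNIV (F_fam F X Y i)"

definition F_diff_Y where
  "F_diff_Y X Y i j = fmor F (term_at X j, term_at Y (i + j)) (term_at X j, term_at Y (i + 1 + j))
     (Ident C (term_at X j), diff_at Y (i + j))"

definition F_diff_X where
  "F_diff_X X Y i j = fmor F (term_at X (j + 1), term_at Y (i + 1 + j)) (term_at X j, term_at Y (i + 1 + j))
     (diff_at X j, Ident C' (term_at Y (i + 1 + j)))"

abbreviation tot_diff where "tot_diff X Y \<equiv> diff_at (fobj (F_xi R C C' D F \<xi>) (X, Y))"

text \<open>
  \<open>F(d\<^sub>X\<^sup>m, d\<^sub>Y\<^sup>n)\<close> from the \<open>(j + m)\<close>-th entry of degree \<open>i\<close> to the \<open>j\<close>-th entry of degree \<open>i + m + n\<close>,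
  and the same after the projection of the total complex.
\<close>

definition F_pow where
  "F_pow X Y i j m n = fmor F
     (term_at X (j + int m), term_at Y (i + (j + int m)))
     (term_at X j, term_at Y (i + int (m + n) + j))
     (diff_pow C X m j, diff_pow C' Y n (i + (j + int m)))"

definition F_pow_proj where
  "F_pow_proj X Y i j m n = Comp D (tot_obj X Y i) (F_fam F X Y i (j + int m)) (F_fam F X Y (i + int (m + n)) j)
     (F_pow X Y i j m n) (tot_proj X Y i (j + int m))"

lemma xi_pow_closed: "\<xi> [^]\<^bsub>R\<^esub> (i::int) \<in> carrier R"
  by (rule R.Units_int_pow_closed[OF xi_unit])

lemma minus_smult_closed:
  assumes "A \<in> Obj D" "B \<in> Obj D" "f \<in> Hom D A B" "g \<in> Hom D A B" "a \<in> carrier R"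
  shows "f \<ominus>\<^bsub>HomM D A B\<^esub> a \<odot>\<^bsub>HomM D A B\<^esub> g \<in> Hom D A B"
proof -
  interpret M: module R "HomM D A B" using assms by (intro D.HomM_module)
  show ?thesis using assms(3-) unfolding D.carrier_HomM[OF assms(1,2), symmetric] by simp
qed

context
  fixes X Y
  assumes X: "X \<in> Obj (C_inf C)" and Y: "Y \<in> Obj (C_inf C')"
begin

lemmas X_term = C.C_inf_term[OF X] and X_diff = C.C_inf_diff[OF X]
lemmas Y_term = C'.C_inf_term[OF Y] and Y_diff = C'.C_inf_diff[OF Y]

lemma F_fam_closed: "F_fam F X Y i j \<in> Obj D"
  by (simp add: F_fam_def F_obj_closed X_term Y_term)

text \<open>
  The \<open>(j + 1)\<close>-st entry of degree \<open>i\<close> has the \<open>Y\<close>-degree of the \<open>j\<close>-th entry of degree \<open>i + 1\<close>, so it is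
  the source of the differential \<open>d\<^sub>X\<close> into the latter.
\<close>

lemma F_fam_next: "F_fam F X Y i (j + 1) = fobj F (term_at X (j + 1), term_at Y (i + 1 + j))"
  by (simp add: F_fam_def add_ac)

lemma tot_product: "is_product D UNIV (F_fam F X Y i) (tot_obj X Y i) (tot_proj X Y i)"
  by (rule is_product_prod_obj[OF D_products]) (simp_all add: F_fam_closed)

lemma tot_obj_closed: "tot_obj X Y i \<in> Obj D"
  and tot_proj_closed: "tot_proj X Y i j \<in> Hom D (tot_obj X Y i) (F_fam F X Y i j)"
  using tot_product[of i] by (simp_all add: is_product_def)

lemmas tot_ext = is_product_ext[OF tot_product D.category_axioms _ F_fam_closed, simplified]

lemma F_diff_Y_closed: "F_diff_Y X Y i j \<in> Hom D (F_fam F X Y i j) (F_fam F X Y (i + 1) j)"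
  unfolding F_diff_Y_def F_fam_def
  using F_mor_closed X_term Y_term C.Ident_closed Y_diff[of "i + j"] by (simp add: add_ac)

lemma F_diff_X_closed: "F_diff_X X Y i j \<in> Hom D (F_fam F X Y i (j + 1)) (F_fam F X Y (i + 1) j)"
  unfolding F_diff_X_def F_fam_next unfolding F_fam_def
  using F_mor_closed X_term Y_term C'.Ident_closed X_diff by simp

lemma F_diff_comp_eq: "F_diff_comp R C C' D F \<xi> X Y i j
  = Comp D (tot_obj X Y i) (F_fam F X Y i j) (F_fam F X Y (i + 1) j) (F_diff_Y X Y i j) (tot_proj X Y i j)
    \<ominus>\<^bsub>HomM D (tot_obj X Y i) (F_fam F X Y (i + 1) j)\<^esub>
    \<xi> [^]\<^bsub>R\<^esub> i \<odot>\<^bsub>HomM D (tot_obj X Y i) (F_fam F X Y (i + 1) j)\<^esub>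
    Comp D (tot_obj X Y i) (F_fam F X Y i (j + 1)) (F_fam F X Y (i + 1) j) (F_diff_X X Y i j) (tot_proj X Y i (j + 1))"
  unfolding F_diff_comp_def Let_def F_diff_X_def F_diff_Y_def ..

lemma F_diff_comp_closed:
  "F_diff_comp R C C' D F \<xi> X Y i j \<in> Hom D (tot_obj X Y i) (F_fam F X Y (i + 1) j)"
  unfolding F_diff_comp_eq
  by (intro minus_smult_closed D.Comp_closed tot_obj_closed F_fam_closed F_diff_X_closed F_diff_Y_closed
      tot_proj_closed xi_pow_closed)

lemma tot_diff_eq: "tot_diff X Y i
  = prod_tuple D UNIV (F_fam F X Y (i + 1)) (tot_obj X Y i) (F_diff_comp R C C' D F \<xi> X Y i)"
  by (simp add: F_xi_def)

lemma tot_term: "term_at (fobj (F_xi R C C' D F \<xi>) (X, Y)) i = tot_obj X Y i"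
  by (simp add: F_xi_def)

lemma tot_diff_closed: "tot_diff X Y i \<in> Hom D (tot_obj X Y i) (tot_obj X Y (i + 1))"
  unfolding tot_diff_eq
  by (rule prod_tuple_closed[OF tot_product tot_obj_closed F_diff_comp_closed])

lemma tot_proj_diff:
  "Comp D (tot_obj X Y i) (tot_obj X Y (i + 1)) (F_fam F X Y (i + 1) j) (tot_proj X Y (i + 1) j) (tot_diff X Y i)
    = F_diff_comp R C C' D F \<xi> X Y i j"
  unfolding tot_diff_eq
  by (rule prod_proj_tuple[OF tot_product tot_obj_closed F_diff_comp_closed UNIV_I])

lemma F_xi_fobj_closed: "fobj (F_xi R C C' D F \<xi>) (X, Y) \<in> Obj (C_inf D)"
  unfolding C_inf_def using tot_term tot_obj_closed tot_diff_closed by simp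

text \<open>
  The form in which the differential is used: \<open>h\<close> will be an iterated differential in the expansion
  of \<open>d\<^sup>n\<close>, and \<open>F\<^sub>\<xi>(f, g)\<close> in the proof that the latter is a morphism of complexes.
\<close>

lemma tot_proj_diff_Comp:
  assumes A: "A \<in> Obj D" and h: "h \<in> Hom D A (tot_obj X Y i)"
  shows "Comp D A (tot_obj X Y (i + 1)) (F_fam F X Y (i + 1) j) (tot_proj X Y (i + 1) j)
      (Comp D A (tot_obj X Y i) (tot_obj X Y (i + 1)) (tot_diff X Y i) h)
    = Comp D A (F_fam F X Y i j) (F_fam F X Y (i + 1) j) (F_diff_Y X Y i j)
        (Comp D A (tot_obj X Y i) (F_fam F X Y i j) (tot_proj X Y i j) h)
      \<ominus>\<^bsub>HomM D A (F_fam F X Y (i + 1) j)\<^esub>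
      \<xi> [^]\<^bsub>R\<^esub> i \<odot>\<^bsub>HomM D A (F_fam F X Y (i + 1) j)\<^esub>
      Comp D A (F_fam F X Y i (j + 1)) (F_fam F X Y (i + 1) j) (F_diff_X X Y i j)
        (Comp D A (tot_obj X Y i) (F_fam F X Y i (j + 1)) (tot_proj X Y i (j + 1)) h)"
proof -
  note cl = A h tot_obj_closed F_fam_closed F_diff_X_closed F_diff_Y_closed tot_proj_closed tot_diff_closed xi_pow_closed
  let ?Q = "F_fam F X Y (i + 1) j" and ?P = "tot_obj X Y i"
  have smult: "a \<odot>\<^bsub>HomM D ?P ?Q\<^esub> f \<in> Hom D ?P ?Q" if "a \<in> carrier R" "f \<in> Hom D ?P ?Q" for a f
    using module.smult_closed[OF D.HomM_module[of ?P ?Q] that(1)] that(2) by (simp add: D.carrier_HomM cl)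
  have "Comp D A (tot_obj X Y (i + 1)) ?Q (tot_proj X Y (i + 1) j)
      (Comp D A ?P (tot_obj X Y (i + 1)) (tot_diff X Y i) h)
    = Comp D A ?P ?Q (F_diff_comp R C C' D F \<xi> X Y i j) h"
    using tot_proj_diff[of i j] cl by (simp add: D.Comp_assoc)
  also have "\<dots> = Comp D A ?P ?Q (Comp D ?P (F_fam F X Y i j) ?Q (F_diff_Y X Y i j) (tot_proj X Y i j)) h
      \<ominus>\<^bsub>HomM D A ?Q\<^esub>
      Comp D A ?P ?Q (\<xi> [^]\<^bsub>R\<^esub> i \<odot>\<^bsub>HomM D ?P ?Q\<^esub>
        Comp D ?P (F_fam F X Y i (j + 1)) ?Q (F_diff_X X Y i j) (tot_proj X Y i (j + 1))) h"
    unfolding F_diff_comp_eq by (intro D.Comp_minus_left smult D.Comp_closed cl)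
  also have "Comp D A ?P ?Q (\<xi> [^]\<^bsub>R\<^esub> i \<odot>\<^bsub>HomM D ?P ?Q\<^esub>
        Comp D ?P (F_fam F X Y i (j + 1)) ?Q (F_diff_X X Y i j) (tot_proj X Y i (j + 1))) h
    = \<xi> [^]\<^bsub>R\<^esub> i \<odot>\<^bsub>HomM D A ?Q\<^esub>
        Comp D A ?P ?Q (Comp D ?P (F_fam F X Y i (j + 1)) ?Q (F_diff_X X Y i j) (tot_proj X Y i (j + 1))) h"
    by (intro D.Comp_smult_left D.Comp_closed cl)
  also have "Comp D A ?P ?Q (Comp D ?P (F_fam F X Y i (j + 1)) ?Q (F_diff_X X Y i j) (tot_proj X Y i (j + 1))) h
    = Comp D A (F_fam F X Y i (j + 1)) ?Q (F_diff_X X Y i j)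
        (Comp D A ?P (F_fam F X Y i (j + 1)) (tot_proj X Y i (j + 1)) h)"
    by (intro D.Comp_assoc[symmetric] cl)
  also have "Comp D A ?P ?Q (Comp D ?P (F_fam F X Y i j) ?Q (F_diff_Y X Y i j) (tot_proj X Y i j)) h
    = Comp D A (F_fam F X Y i j) ?Q (F_diff_Y X Y i j)
        (Comp D A ?P (F_fam F X Y i j) (tot_proj X Y i j) h)"
    by (intro D.Comp_assoc[symmetric] cl)
  finally show ?thesis .
qed

lemma F_pow_closed: "F_pow X Y i j m n \<in> Hom D (F_fam F X Y i (j + int m)) (F_fam F X Y (i + int (m + n)) j)"
proof -
  have eq: "i + int (m + n) + j = i + (j + int m) + int n" by simp
  show ?thesis
    unfolding F_pow_def F_fam_def eq
    by (intro F_mor_closed X_term Y_term C.diff_pow_closed[OF X] C'.diff_pow_closed[OF Y])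
qed

lemma F_pow_proj_closed: "F_pow_proj X Y i j m n \<in> Hom D (tot_obj X Y i) (F_fam F X Y (i + int (m + n)) j)"
  unfolding F_pow_proj_def by (intro D.Comp_closed F_pow_closed tot_proj_closed tot_obj_closed F_fam_closed)

lemma F_diff_Y_F_pow:
  "Comp D (F_fam F X Y i (j + int m)) (F_fam F X Y (i + int (m + n)) j) (F_fam F X Y (i + int (m + n) + 1) j)
     (F_diff_Y X Y (i + int (m + n)) j) (F_pow X Y i j m n) = F_pow X Y i j m (Suc n)"
proof -
  have eq: "i + int (m + n) + j = i + (j + int m) + int n"
    "i + int (m + n) + 1 + j = i + (j + int m) + int n + 1"
    "i + int (m + Suc n) + j = i + (j + int m) + int n + 1" by simp_all
  have C: "Comp C (term_at X j) (term_at X j) (term_at X (j + int m)) (diff_pow C X m j) (Ident C (term_at X j))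
      = diff_pow C X m j"
    by (intro C.Comp_Ident_right X_term C.diff_pow_closed X)
  show ?thesis
    unfolding F_diff_Y_def F_pow_def F_fam_def eq
    by (subst F_mor_Comp) (simp_all only: X_term Y_term C.Ident_closed Y_diff C.diff_pow_closed[OF X]
        C'.diff_pow_closed[OF Y] C diff_pow.simps)
qed

lemma F_diff_X_F_pow:
  "Comp D (F_fam F X Y i (j + 1 + int m)) (F_fam F X Y (i + int (m + n)) (j + 1)) (F_fam F X Y (i + int (m + n) + 1) j)
     (F_diff_X X Y (i + int (m + n)) j) (F_pow X Y i (j + 1) m n) = F_pow X Y i j (Suc m) n"
proof -
  have eq: "i + int (m + n) + (j + 1) = i + (j + 1 + int m) + int n"
    "i + int (m + n) + 1 + j = i + (j + 1 + int m) + int n"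
    "i + int (Suc m + n) + j = i + (j + 1 + int m) + int n"
    "j + int (Suc m) = j + 1 + int m" by simp_all
  have C: "Comp C' (term_at Y k) (term_at Y (k + int n)) (term_at Y (k + int n)) (Ident C' (term_at Y (k + int n)))
      (diff_pow C' Y n k) = diff_pow C' Y n k" for k
    by (intro C'.Comp_Ident_left Y_term C'.diff_pow_closed Y)
  show ?thesis
    unfolding F_diff_X_def F_pow_def F_fam_def eq
    by (subst F_mor_Comp) (simp_all only: X_term Y_term C'.Ident_closed X_diff C.diff_pow_closed[OF X]
        C'.diff_pow_closed[OF Y] C C.diff_pow_Suc_front[OF X])
qed

lemma F_diff_Y_F_pow_proj:
  "Comp D (tot_obj X Y i) (F_fam F X Y (i + int (m + n)) j) (F_fam F X Y (i + int (m + n) + 1) j)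
     (F_diff_Y X Y (i + int (m + n)) j) (F_pow_proj X Y i j m n) = F_pow_proj X Y i j m (Suc n)"
proof -
  have "i + int (m + Suc n) = i + int (m + n) + 1" by simp
  moreover have "Comp D (tot_obj X Y i) (F_fam F X Y (i + int (m + n)) j) (F_fam F X Y (i + int (m + n) + 1) j)
     (F_diff_Y X Y (i + int (m + n)) j) (F_pow_proj X Y i j m n)
    = Comp D (tot_obj X Y i) (F_fam F X Y i (j + int m)) (F_fam F X Y (i + int (m + n) + 1) j)
      (F_pow X Y i j m (Suc n)) (tot_proj X Y i (j + int m))"
    unfolding F_pow_proj_def F_diff_Y_F_pow[symmetric]
    by (intro D.Comp_assoc tot_obj_closed F_fam_closed F_pow_closed tot_proj_closed F_diff_Y_closed)
  ultimately show ?thesis by (simp only: F_pow_proj_def)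
qed

lemma F_diff_X_F_pow_proj:
  "Comp D (tot_obj X Y i) (F_fam F X Y (i + int (m + n)) (j + 1)) (F_fam F X Y (i + int (m + n) + 1) j)
     (F_diff_X X Y (i + int (m + n)) j) (F_pow_proj X Y i (j + 1) m n) = F_pow_proj X Y i j (Suc m) n"
proof -
  have "i + int (Suc m + n) = i + int (m + n) + 1" "j + int (Suc m) = j + 1 + int m" by simp_all
  moreover have "Comp D (tot_obj X Y i) (F_fam F X Y (i + int (m + n)) (j + 1)) (F_fam F X Y (i + int (m + n) + 1) j)
     (F_diff_X X Y (i + int (m + n)) j) (F_pow_proj X Y i (j + 1) m n)
    = Comp D (tot_obj X Y i) (F_fam F X Y i (j + 1 + int m)) (F_fam F X Y (i + int (m + n) + 1) j)
      (F_pow X Y i j (Suc m) n) (tot_proj X Y i (j + 1 + int m))"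
    unfolding F_pow_proj_def F_diff_X_F_pow[symmetric]
    by (intro D.Comp_assoc tot_obj_closed F_fam_closed F_pow_closed tot_proj_closed F_diff_X_closed)
  ultimately show ?thesis by (simp only: F_pow_proj_def)
qed

text \<open>
  The expansion of the \<open>n\<close>-th power of the differential, entry by entry, by induction on \<open>n\<close>.  The
  induction hypothesis is needed for the entries \<open>j\<close> and \<open>j + 1\<close>; the last differential, in degree
  \<open>i + n\<close>, contributes the factor \<open>\<xi>\<^sup>i\<^sup>+\<^sup>n = w \<xi>\<^sup>n\<close>.
\<close>

lemma tot_proj_diff_pow:
  defines "Z \<equiv> fobj (F_xi R C C' D F \<xi>) (X, Y)"
  shows "Comp D (tot_obj X Y i) (tot_obj X Y (i + int n)) (F_fam F X Y (i + int n) j)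
      (tot_proj X Y (i + int n) j) (diff_pow D Z n i)
    = (\<Oplus>\<^bsub>HomM D (tot_obj X Y i) (F_fam F X Y (i + int n) j)\<^esub>s\<in>{..n}.
        R.twisted_coeff \<xi> (\<xi> [^]\<^bsub>R\<^esub> i) n s
          \<odot>\<^bsub>HomM D (tot_obj X Y i) (F_fam F X Y (i + int n) j)\<^esub> F_pow_proj X Y i j s (n - s))"
proof (induction n arbitrary: j)
  case 0
  interpret M: module R "HomM D (tot_obj X Y i) (F_fam F X Y i j)"
    by (intro D.HomM_module tot_obj_closed F_fam_closed)
  have "F_pow X Y i j 0 0 = Ident D (F_fam F X Y i j)"
    using F_mor_Ident X_term Y_term by (simp add: F_pow_def F_fam_def)
  then have "F_pow_proj X Y i j 0 0 = tot_proj X Y i j"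
    using tot_obj_closed F_fam_closed tot_proj_closed by (simp add: F_pow_proj_def D.Comp_Ident_left)
  moreover have "tot_proj X Y i j \<in> carrier (HomM D (tot_obj X Y i) (F_fam F X Y i j))"
    using tot_obj_closed F_fam_closed tot_proj_closed by (simp add: D.carrier_HomM)
  ultimately show ?case
    using tot_obj_closed F_fam_closed tot_proj_closed
    by (simp add: Z_def tot_term D.Comp_Ident_right)
next
  case (Suc n)
  let ?P = "tot_obj X Y i" and ?Q = "F_fam F X Y (i + int n + 1) j" and ?w = "\<xi> [^]\<^bsub>R\<^esub> i"
  have xi: "\<xi> \<in> carrier R" using xi_unit by (rule R.Units_closed)
  note obj = tot_obj_closed F_fam_closed
  interpret M: module R "HomM D ?P ?Q" by (intro D.HomM_module obj)
  have i: "i + int (Suc n) = i + int n + 1" by simp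
  have c: "R.twisted_coeff \<xi> ?w n s \<in> carrier R" for s
    by (intro R.twisted_coeff_closed xi xi_pow_closed)
  have F_pow_proj: "F_pow_proj X Y i k s t \<in> Hom D ?P (F_fam F X Y (i + int n) k)" if "s + t = n" for k s t
    using F_pow_proj_closed[of i k s t] that by simp
  have d: "diff_pow D Z n i \<in> Hom D ?P (tot_obj X Y (i + int n))"
    using D.diff_pow_closed[OF F_xi_fobj_closed, of n i] by (simp add: Z_def tot_term)
  have Y_step: "Comp D ?P (F_fam F X Y (i + int n) j) ?Q (F_diff_Y X Y (i + int n) j)
      (F_pow_proj X Y i j s (n - s)) = F_pow_proj X Y i j s (Suc n - s)" if "s \<in> {..n}" for s
    using F_diff_Y_F_pow_proj[of i s "n - s" j] that by (simp add: Suc_diff_le)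
  have X_step: "Comp D ?P (F_fam F X Y (i + int n) (j + 1)) ?Q (F_diff_X X Y (i + int n) j)
      (F_pow_proj X Y i (j + 1) s (n - s)) = F_pow_proj X Y i j (Suc s) (n - s)" if "s \<in> {..n}" for s
    using F_diff_X_F_pow_proj[of i s "n - s" j] that by simp
  have F_pow_proj': "F_pow_proj X Y i j s (Suc n - s) \<in> carrier (HomM D ?P ?Q)" if "s \<le> Suc n" for s
    using F_pow_proj_closed[of i j s "Suc n - s"] that unfolding D.carrier_HomM[OF obj] i[symmetric] by simp
  have "Comp D ?P (tot_obj X Y (i + int (Suc n))) (F_fam F X Y (i + int (Suc n)) j)
      (tot_proj X Y (i + int (Suc n)) j) (diff_pow D Z (Suc n) i)
    = Comp D ?P (F_fam F X Y (i + int n) j) ?Q (F_diff_Y X Y (i + int n) j)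
        (Comp D ?P (tot_obj X Y (i + int n)) (F_fam F X Y (i + int n) j) (tot_proj X Y (i + int n) j) (diff_pow D Z n i))
      \<ominus>\<^bsub>HomM D ?P ?Q\<^esub> \<xi> [^]\<^bsub>R\<^esub> (i + int n) \<odot>\<^bsub>HomM D ?P ?Q\<^esub>
      Comp D ?P (F_fam F X Y (i + int n) (j + 1)) ?Q (F_diff_X X Y (i + int n) j)
        (Comp D ?P (tot_obj X Y (i + int n)) (F_fam F X Y (i + int n) (j + 1)) (tot_proj X Y (i + int n) (j + 1)) (diff_pow D Z n i))"
    unfolding i diff_pow.simps Z_def tot_term
    by (rule tot_proj_diff_Comp[OF tot_obj_closed d[unfolded Z_def]])
  also have "Comp D ?P (F_fam F X Y (i + int n) j) ?Q (F_diff_Y X Y (i + int n) j)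
        (Comp D ?P (tot_obj X Y (i + int n)) (F_fam F X Y (i + int n) j) (tot_proj X Y (i + int n) j) (diff_pow D Z n i))
    = (\<Oplus>\<^bsub>HomM D ?P ?Q\<^esub>s\<in>{..n}. R.twisted_coeff \<xi> ?w n s \<odot>\<^bsub>HomM D ?P ?Q\<^esub>
        Comp D ?P (F_fam F X Y (i + int n) j) ?Q (F_diff_Y X Y (i + int n) j) (F_pow_proj X Y i j s (n - s)))"
    unfolding Suc.IH by (rule D.Comp_lincomb_right[OF obj F_fam_closed]) (simp_all add: F_diff_Y_closed c F_pow_proj)
  also have "\<dots> = (\<Oplus>\<^bsub>HomM D ?P ?Q\<^esub>s\<in>{..n}. R.twisted_coeff \<xi> ?w n s \<odot>\<^bsub>HomM D ?P ?Q\<^esub> F_pow_proj X Y i j s (Suc n - s))"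
    using F_pow_proj' c by (intro M.M.finsum_cong') (auto simp: Y_step)
  also have "Comp D ?P (F_fam F X Y (i + int n) (j + 1)) ?Q (F_diff_X X Y (i + int n) j)
        (Comp D ?P (tot_obj X Y (i + int n)) (F_fam F X Y (i + int n) (j + 1)) (tot_proj X Y (i + int n) (j + 1)) (diff_pow D Z n i))
    = (\<Oplus>\<^bsub>HomM D ?P ?Q\<^esub>s\<in>{..n}. R.twisted_coeff \<xi> ?w n s \<odot>\<^bsub>HomM D ?P ?Q\<^esub>
        Comp D ?P (F_fam F X Y (i + int n) (j + 1)) ?Q (F_diff_X X Y (i + int n) j) (F_pow_proj X Y i (j + 1) s (n - s)))"
    unfolding Suc.IH by (rule D.Comp_lincomb_right[OF obj F_fam_closed]) (simp_all add: F_diff_X_closed c F_pow_proj)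
  also have "\<dots> = (\<Oplus>\<^bsub>HomM D ?P ?Q\<^esub>s\<in>{..n}. R.twisted_coeff \<xi> ?w n s \<odot>\<^bsub>HomM D ?P ?Q\<^esub> F_pow_proj X Y i j (Suc s) (Suc n - Suc s))"
    using F_pow_proj'[of "Suc _"] c by (intro M.M.finsum_cong') (auto simp: X_step)
  also have "\<xi> [^]\<^bsub>R\<^esub> (i + int n) = ?w \<otimes>\<^bsub>R\<^esub> \<xi> [^]\<^bsub>R\<^esub> n"
    by (rule R.Units_int_pow_add_nat[OF xi_unit])
  finally show ?case
    unfolding i by (subst M.twisted_sum_Suc[OF xi xi_pow_closed F_pow_proj']) simp_all
qed

text \<open>
  Every summand of the expansion vanishes: the outer ones because \<open>X\<close> and \<open>Y\<close> are \<open>N\<close>-complexes and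
  \<open>F\<close> is linear in each variable, the inner ones by the twisted Leibniz rule.
\<close>

lemma tot_diff_pow_zero:
  assumes "domain R" and L: "allows_twisted_Leibniz R D N \<xi>"
    and XN: "\<And>i. diff_pow C X N i = \<zero>\<^bsub>HomM C (term_at X i) (term_at X (i + int N))\<^esub>"
    and YN: "\<And>i. diff_pow C' Y N i = \<zero>\<^bsub>HomM C' (term_at Y i) (term_at Y (i + int N))\<^esub>"
  shows "diff_pow D (fobj (F_xi R C C' D F \<xi>) (X, Y)) N i
    = \<zero>\<^bsub>HomM D (tot_obj X Y i) (tot_obj X Y (i + int N))\<^esub>" (is "?d = ?z")
proof (rule tot_ext[of "tot_obj X Y i"])
  note obj = tot_obj_closed F_fam_closed
  show "tot_obj X Y i \<in> Obj D" by (rule tot_obj_closed)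
  show "?d \<in> Hom D (tot_obj X Y i) (tot_obj X Y (i + int N))"
    using D.diff_pow_closed[OF F_xi_fobj_closed, of N i] by (simp add: tot_term)
  show "?z \<in> Hom D (tot_obj X Y i) (tot_obj X Y (i + int N))"
    by (intro D.zero_closed obj)
  fix j
  let ?P = "tot_obj X Y i" and ?Q = "F_fam F X Y (i + int N) j"
  interpret M: module R "HomM D ?P ?Q" by (intro D.HomM_module obj)
  have summand_zero: "R.twisted_coeff \<xi> (\<xi> [^]\<^bsub>R\<^esub> i) N s \<odot>\<^bsub>HomM D ?P ?Q\<^esub> F_pow_proj X Y i j s (N - s)
      = \<zero>\<^bsub>HomM D ?P ?Q\<^esub>" if s: "s \<le> N" for s
  proof -
    have c: "R.twisted_coeff \<xi> (\<xi> [^]\<^bsub>R\<^esub> i) N s \<in> carrier R"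
      by (intro R.twisted_coeff_closed xi_pow_closed R.Units_closed[OF xi_unit])
    have p: "F_pow_proj X Y i j s (N - s) \<in> Hom D ?P ?Q"
      using F_pow_proj_closed[of i j s "N - s"] s by simp
    have eq: "i + int N + j = i + j + int N" "i + (j + int N) = i + j + int N" by simp_all
    consider "s = 0" | "s = N" | "0 < s" "s < N" using s by linarith
    then show ?thesis
    proof cases
      case 1
      have "F_pow X Y i j 0 N = \<zero>\<^bsub>HomM D (F_fam F X Y i j) ?Q\<^esub>"
        unfolding F_pow_def F_fam_def YN
        using F_mor_zero_second[OF X_term X_term Y_term Y_term C.Ident_closed[OF X_term], of j "i + j" "i + j + int N"]
        by (simp add: eq)
      then have "F_pow_proj X Y i j 0 N = \<zero>\<^bsub>HomM D ?P ?Q\<^esub>"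
        unfolding F_pow_proj_def using D.Comp_zero_left[OF obj F_fam_closed tot_proj_closed] by simp
      with c 1 show ?thesis by simp
    next
      case 2
      have "F_pow X Y i j N 0 = \<zero>\<^bsub>HomM D (F_fam F X Y i (j + int N)) ?Q\<^esub>"
        unfolding F_pow_def F_fam_def XN
        using F_mor_zero_first[OF X_term X_term Y_term Y_term C'.Ident_closed[OF Y_term], of "j + int N" "i + j + int N" j]
        by (simp add: eq)
      then have "F_pow_proj X Y i j N 0 = \<zero>\<^bsub>HomM D ?P ?Q\<^esub>"
        unfolding F_pow_proj_def using D.Comp_zero_left[OF obj F_fam_closed tot_proj_closed] by simp
      with c 2 show ?thesis by simp
    next
      case 3
      show ?thesis
        by (rule twisted_Leibniz_coeff_vanish[OF \<open>domain R\<close> D.linear_category_axioms L xi_pow_closed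
            obj p 3])
    qed
  qed
  have "Comp D ?P (tot_obj X Y (i + int N)) ?Q (tot_proj X Y (i + int N) j) ?d
    = (\<Oplus>\<^bsub>HomM D ?P ?Q\<^esub>s\<in>{..N}. \<zero>\<^bsub>HomM D ?P ?Q\<^esub>)"
    unfolding tot_proj_diff_pow by (rule M.M.finsum_cong') (auto simp: summand_zero)
  also have "\<dots> = \<zero>\<^bsub>HomM D ?P ?Q\<^esub>" by (rule M.M.finsum_zero)
  also have "\<dots> = Comp D ?P (tot_obj X Y (i + int N)) ?Q (tot_proj X Y (i + int N) j) ?z"
    by (rule D.Comp_zero_right[OF tot_obj_closed tot_obj_closed F_fam_closed tot_proj_closed, symmetric])
  finally show "Comp D ?P (tot_obj X Y (i + int N)) ?Q (tot_proj X Y (i + int N) j) ?d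
    = Comp D ?P (tot_obj X Y (i + int N)) ?Q (tot_proj X Y (i + int N) j) ?z" .
qed

end

section \<open>Functoriality\<close>

abbreviation tot_map where "tot_map X Y X' Y' f g \<equiv> fmor (F_xi R C C' D F \<xi>) (X, Y) (X', Y') (f, g)"

lemma tot_map_eq: "tot_map X Y X' Y' f g i
  = prod_map D UNIV (F_fam F X Y i) (F_fam F X' Y' i)
      (\<lambda>j. fmor F (term_at X j, term_at Y (i + j)) (term_at X' j, term_at Y' (i + j)) (f j, g (i + j)))"
  by (simp add: F_xi_def)

context
  fixes X Y X' Y' f g
  assumes X: "X \<in> Obj (C_inf C)" and Y: "Y \<in> Obj (C_inf C')"
    and X': "X' \<in> Obj (C_inf C)" and Y': "Y' \<in> Obj (C_inf C')"
    and f: "f \<in> Hom (C_inf C) X' X" and g: "g \<in> Hom (C_inf C') Y Y'"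
begin

lemmas map_obj = C.C_inf_term[OF X] C'.C_inf_term[OF Y] C.C_inf_term[OF X'] C'.C_inf_term[OF Y']
  C.C_inf_diff[OF X] C'.C_inf_diff[OF Y] C.C_inf_diff[OF X'] C'.C_inf_diff[OF Y']
  C.C_inf_hom_closed[OF f] C'.C_inf_hom_closed[OF g] C.Ident_closed C'.Ident_closed

lemma F_mor_map_closed:
  "fmor F (term_at X j, term_at Y k) (term_at X' j, term_at Y' k) (f j, g k)
    \<in> Hom D (fobj F (term_at X j, term_at Y k)) (fobj F (term_at X' j, term_at Y' k))"
  by (intro F_mor_closed map_obj)

lemma tot_map_closed: "tot_map X Y X' Y' f g i \<in> Hom D (tot_obj X Y i) (tot_obj X' Y' i)"
  and tot_proj_map: "Comp D (tot_obj X Y i) (tot_obj X' Y' i) (F_fam F X' Y' i j)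
      (tot_proj X' Y' i j) (tot_map X Y X' Y' f g i)
    = Comp D (tot_obj X Y i) (F_fam F X Y i j) (F_fam F X' Y' i j)
      (fmor F (term_at X j, term_at Y (i + j)) (term_at X' j, term_at Y' (i + j)) (f j, g (i + j)))
      (tot_proj X Y i j)"
proof -
  have "Comp D (tot_obj X Y i) (F_fam F X Y i j) (F_fam F X' Y' i j)
      (fmor F (term_at X j, term_at Y (i + j)) (term_at X' j, term_at Y' (i + j)) (f j, g (i + j)))
      (tot_proj X Y i j) \<in> Hom D (tot_obj X Y i) (F_fam F X' Y' i j)" for j
    using F_mor_map_closed[of j "i + j", folded F_fam_def]
    by (intro D.Comp_closed tot_obj_closed[OF X Y] F_fam_closed[OF X Y] F_fam_closed[OF X' Y'] tot_proj_closed[OF X Y])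
  note * = prod_tuple[OF tot_product[OF X' Y'] tot_obj_closed[OF X Y] this]
  show "tot_map X Y X' Y' f g i \<in> Hom D (tot_obj X Y i) (tot_obj X' Y' i)"
    unfolding tot_map_eq prod_map_def by (rule *(1))
  show "Comp D (tot_obj X Y i) (tot_obj X' Y' i) (F_fam F X' Y' i j)
      (tot_proj X' Y' i j) (tot_map X Y X' Y' f g i)
    = Comp D (tot_obj X Y i) (F_fam F X Y i j) (F_fam F X' Y' i j)
      (fmor F (term_at X j, term_at Y (i + j)) (term_at X' j, term_at Y' (i + j)) (f j, g (i + j)))
      (tot_proj X Y i j)"
    unfolding tot_map_eq prod_map_def by (rule *(2)) simp
qed

text \<open>
  The two differentials of the double complex are natural: functoriality of \<open>F\<close> reduces this to
  \<open>g\<close>, respectively \<open>f\<close>, being a morphism of complexes.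
\<close>

lemma F_diff_Y_map:
  "Comp D (F_fam F X Y i j) (F_fam F X' Y' i j) (F_fam F X' Y' (i + 1) j) (F_diff_Y X' Y' i j)
     (fmor F (term_at X j, term_at Y (i + j)) (term_at X' j, term_at Y' (i + j)) (f j, g (i + j)))
   = Comp D (F_fam F X Y i j) (F_fam F X Y (i + 1) j) (F_fam F X' Y' (i + 1) j)
     (fmor F (term_at X j, term_at Y (i + 1 + j)) (term_at X' j, term_at Y' (i + 1 + j)) (f j, g (i + 1 + j)))
     (F_diff_Y X Y i j)"
proof -
  have eq: "i + 1 + j = i + j + 1" by simp
  show ?thesis
    unfolding F_diff_Y_def F_fam_def eq
    by (subst (1 2) F_mor_Comp)
      (simp_all only: map_obj C'.C_inf_hom_diff[OF g] C.Comp_Ident_left C.Comp_Ident_right)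
qed

lemma F_diff_X_map:
  "Comp D (F_fam F X Y i (j + 1)) (F_fam F X' Y' i (j + 1)) (F_fam F X' Y' (i + 1) j) (F_diff_X X' Y' i j)
     (fmor F (term_at X (j + 1), term_at Y (i + (j + 1))) (term_at X' (j + 1), term_at Y' (i + (j + 1)))
       (f (j + 1), g (i + (j + 1))))
   = Comp D (F_fam F X Y i (j + 1)) (F_fam F X Y (i + 1) j) (F_fam F X' Y' (i + 1) j)
     (fmor F (term_at X j, term_at Y (i + 1 + j)) (term_at X' j, term_at Y' (i + 1 + j)) (f j, g (i + 1 + j)))
     (F_diff_X X Y i j)"
proof -
  have eq: "i + (j + 1) = i + 1 + j" by simp
  show ?thesis
    unfolding F_diff_X_def F_fam_def eq
    by (subst (1 2) F_mor_Comp)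
      (simp_all only: map_obj C.C_inf_hom_diff[OF f] C'.Comp_Ident_left C'.Comp_Ident_right)
qed

text \<open>
  Both sides agree after every projection: there they are \<open>F(f, g)\<close> composed with the components of the
  differential, where bilinearity of the composition separates \<open>d\<^sub>Y\<close> from \<open>\<xi>\<^sup>i d\<^sub>X\<close>.
\<close>

lemma tot_map_diff:
  "Comp D (tot_obj X Y i) (tot_obj X' Y' i) (tot_obj X' Y' (i + 1)) (tot_diff X' Y' i) (tot_map X Y X' Y' f g i)
   = Comp D (tot_obj X Y i) (tot_obj X Y (i + 1)) (tot_obj X' Y' (i + 1)) (tot_map X Y X' Y' f g (i + 1)) (tot_diff X Y i)"
  (is "?l = ?r")
proof (rule tot_ext[OF X' Y', of "tot_obj X Y i"])
  note obj = tot_obj_closed[OF X Y] F_fam_closed[OF X Y] tot_obj_closed[OF X' Y'] F_fam_closed[OF X' Y']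
  note mor = tot_proj_closed[OF X Y] tot_diff_closed[OF X Y] F_diff_X_closed[OF X Y] F_diff_Y_closed[OF X Y]
    tot_proj_closed[OF X' Y'] tot_diff_closed[OF X' Y'] F_diff_X_closed[OF X' Y'] F_diff_Y_closed[OF X' Y']
    tot_map_closed
  show "tot_obj X Y i \<in> Obj D" by (rule obj)
  show "?l \<in> Hom D (tot_obj X Y i) (tot_obj X' Y' (i + 1))" "?r \<in> Hom D (tot_obj X Y i) (tot_obj X' Y' (i + 1))"
    by (intro D.Comp_closed obj mor)+
  fix j
  let ?P = "tot_obj X Y i" and ?Q = "F_fam F X' Y' (i + 1) j" and ?S = "F_fam F X Y (i + 1) j"
  let ?m = "\<lambda>i j. fmor F (term_at X j, term_at Y (i + j)) (term_at X' j, term_at Y' (i + j)) (f j, g (i + j))"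
  have m: "?m i j \<in> Hom D (F_fam F X Y i j) (F_fam F X' Y' i j)" for i j
    unfolding F_fam_def by (rule F_mor_map_closed)
  let ?sub = "\<lambda>A B u v. u \<ominus>\<^bsub>HomM D A B\<^esub> \<xi> [^]\<^bsub>R\<^esub> i \<odot>\<^bsub>HomM D A B\<^esub> v"
  have Y_part: "Comp D ?P (F_fam F X' Y' i j) ?Q (F_diff_Y X' Y' i j)
        (Comp D ?P (tot_obj X' Y' i) (F_fam F X' Y' i j) (tot_proj X' Y' i j) (tot_map X Y X' Y' f g i))
    = Comp D ?P ?S ?Q (?m (i + 1) j)
        (Comp D ?P (F_fam F X Y i j) ?S (F_diff_Y X Y i j) (tot_proj X Y i j))"
    unfolding tot_proj_map using obj mor m F_diff_Y_map[of i j] by (simp add: D.Comp_assoc)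
  have X_part: "Comp D ?P (F_fam F X' Y' i (j + 1)) ?Q (F_diff_X X' Y' i j)
        (Comp D ?P (tot_obj X' Y' i) (F_fam F X' Y' i (j + 1)) (tot_proj X' Y' i (j + 1)) (tot_map X Y X' Y' f g i))
    = Comp D ?P ?S ?Q (?m (i + 1) j)
        (Comp D ?P (F_fam F X Y i (j + 1)) ?S (F_diff_X X Y i j) (tot_proj X Y i (j + 1)))"
    unfolding tot_proj_map using obj mor m F_diff_X_map[of i j]
    by (simp only: D.Comp_assoc)
  have dY: "Comp D ?P (F_fam F X Y i j) ?S (F_diff_Y X Y i j) (tot_proj X Y i j) \<in> Hom D ?P ?S"
    and dX: "Comp D ?P (F_fam F X Y i (j + 1)) ?S (F_diff_X X Y i j) (tot_proj X Y i (j + 1)) \<in> Hom D ?P ?S"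
    by (intro D.Comp_closed obj mor)+
  interpret M: module R "HomM D ?P ?S" by (intro D.HomM_module obj)
  have sdX: "\<xi> [^]\<^bsub>R\<^esub> i \<odot>\<^bsub>HomM D ?P ?S\<^esub> Comp D ?P (F_fam F X Y i (j + 1)) ?S (F_diff_X X Y i j) (tot_proj X Y i (j + 1)) \<in> Hom D ?P ?S"
    using dX xi_pow_closed unfolding D.carrier_HomM[OF obj(1,2), symmetric] by simp
  have "Comp D ?P (tot_obj X' Y' (i + 1)) ?Q (tot_proj X' Y' (i + 1) j) ?l
    = ?sub ?P ?Q
       (Comp D ?P ?S ?Q (?m (i + 1) j)
        (Comp D ?P (F_fam F X Y i j) ?S (F_diff_Y X Y i j) (tot_proj X Y i j)))
       (Comp D ?P ?S ?Q (?m (i + 1) j)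
        (Comp D ?P (F_fam F X Y i (j + 1)) ?S (F_diff_X X Y i j) (tot_proj X Y i (j + 1))))"
    unfolding tot_proj_diff_Comp[OF X' Y' obj(1) tot_map_closed] X_part Y_part ..
  also have "\<dots> = Comp D ?P ?S ?Q (?m (i + 1) j) (F_diff_comp R C C' D F \<xi> X Y i j)"
    unfolding F_diff_comp_eq[OF X Y]
      D.Comp_minus_right[OF obj(1,2,4) m dY sdX] D.Comp_smult_right[OF obj(1,2,4) xi_pow_closed m dX] ..
  also have "\<dots> = Comp D ?P (tot_obj X' Y' (i + 1)) ?Q (tot_proj X' Y' (i + 1) j) ?r"
    unfolding tot_proj_diff[OF X Y, symmetric]
    using tot_proj_map[of "i + 1" j] obj mor m by (simp add: D.Comp_assoc)
  finally show "Comp D ?P (tot_obj X' Y' (i + 1)) ?Q (tot_proj X' Y' (i + 1) j) ?l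
    = Comp D ?P (tot_obj X' Y' (i + 1)) ?Q (tot_proj X' Y' (i + 1) j) ?r" .
qed

lemma F_xi_fmor_closed: "tot_map X Y X' Y' f g
    \<in> Hom (C_inf D) (fobj (F_xi R C C' D F \<xi>) (X, Y)) (fobj (F_xi R C C' D F \<xi>) (X', Y'))"
proof (rule D.C_inf_homI, unfold tot_term[OF X Y] tot_term[OF X' Y'])
  show "tot_map X Y X' Y' f g i \<in> Hom D (tot_obj X Y i) (tot_obj X' Y' i)" for i
    by (rule tot_map_closed)
qed (rule tot_map_diff)

end

lemma tot_map_Ident:
  assumes X: "X \<in> Obj (C_inf C)" and Y: "Y \<in> Obj (C_inf C')"
  shows "tot_map X Y X Y (Ident (C_inf C) X) (Ident (C_inf C') Y) i = Ident D (tot_obj X Y i)"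
proof (rule tot_ext[OF X Y])
  note obj = tot_obj_closed[OF X Y] F_fam_closed[OF X Y] and pr = tot_proj_closed[OF X Y]
  have id: "Ident (C_inf C) X \<in> Hom (C_inf C) X X" "Ident (C_inf C') Y \<in> Hom (C_inf C') Y Y"
    using category.Ident_closed[OF C.category_C_inf X] category.Ident_closed[OF C'.category_C_inf Y] .
  show "tot_obj X Y i \<in> Obj D" "Ident D (tot_obj X Y i) \<in> Hom D (tot_obj X Y i) (tot_obj X Y i)"
    using obj by (auto intro: D.Ident_closed)
  show "tot_map X Y X Y (Ident (C_inf C) X) (Ident (C_inf C') Y) i \<in> Hom D (tot_obj X Y i) (tot_obj X Y i)"
    by (rule tot_map_closed[OF X Y X Y id])
  fix j
  have "fmor F (term_at X j, term_at Y (i + j)) (term_at X j, term_at Y (i + j))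
      (Ident (C_inf C) X j, Ident (C_inf C') Y (i + j)) = Ident D (F_fam F X Y i j)"
    using F_mor_Ident C.C_inf_term[OF X] C'.C_inf_term[OF Y] by (simp add: C.C_inf_Ident C'.C_inf_Ident F_fam_def)
  then show "Comp D (tot_obj X Y i) (tot_obj X Y i) (F_fam F X Y i j) (tot_proj X Y i j)
       (tot_map X Y X Y (Ident (C_inf C) X) (Ident (C_inf C') Y) i)
     = Comp D (tot_obj X Y i) (tot_obj X Y i) (F_fam F X Y i j) (tot_proj X Y i j) (Ident D (tot_obj X Y i))"
    using obj pr by (simp add: tot_proj_map[OF X Y X Y id] D.Comp_Ident_left D.Comp_Ident_right)
qed

lemma tot_map_Comp:
  assumes X: "X \<in> Obj (C_inf C)" and Y: "Y \<in> Obj (C_inf C')"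
    and X': "X' \<in> Obj (C_inf C)" and Y': "Y' \<in> Obj (C_inf C')"
    and X'': "X'' \<in> Obj (C_inf C)" and Y'': "Y'' \<in> Obj (C_inf C')"
    and f: "f \<in> Hom (C_inf C) X' X" and g: "g \<in> Hom (C_inf C') Y Y'"
    and f': "f' \<in> Hom (C_inf C) X'' X'" and g': "g' \<in> Hom (C_inf C') Y' Y''"
  shows "tot_map X Y X'' Y'' (Comp (C_inf C) X'' X' X f f') (Comp (C_inf C') Y Y' Y'' g' g) i
    = Comp D (tot_obj X Y i) (tot_obj X' Y' i) (tot_obj X'' Y'' i)
        (tot_map X' Y' X'' Y'' f' g' i) (tot_map X Y X' Y' f g i)"
    (is "tot_map X Y X'' Y'' ?f ?g i = ?r")
proof (rule tot_ext[OF X'' Y''])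
  note obj = tot_obj_closed[OF X Y] F_fam_closed[OF X Y] tot_obj_closed[OF X' Y'] F_fam_closed[OF X' Y']
    tot_obj_closed[OF X'' Y''] F_fam_closed[OF X'' Y'']
  note pr = tot_proj_closed[OF X Y] tot_proj_closed[OF X' Y'] tot_proj_closed[OF X'' Y'']
  note map = tot_map_closed[OF X Y X' Y' f g] tot_map_closed[OF X' Y' X'' Y'' f' g']
  have fg: "?f \<in> Hom (C_inf C) X'' X" "?g \<in> Hom (C_inf C') Y Y''"
    using category.Comp_closed[OF C.category_C_inf X'' X' X f' f]
      category.Comp_closed[OF C'.category_C_inf Y Y' Y'' g g'] .
  show "tot_obj X Y i \<in> Obj D" by (rule obj)
  show "tot_map X Y X'' Y'' ?f ?g i \<in> Hom D (tot_obj X Y i) (tot_obj X'' Y'' i)"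
    by (rule tot_map_closed[OF X Y X'' Y'' fg])
  show "?r \<in> Hom D (tot_obj X Y i) (tot_obj X'' Y'' i)"
    by (intro D.Comp_closed obj map)
  fix j
  let ?A = "F_fam F X Y i j" and ?A' = "F_fam F X' Y' i j" and ?A'' = "F_fam F X'' Y'' i j"
  let ?m = "fmor F (term_at X j, term_at Y (i + j)) (term_at X' j, term_at Y' (i + j)) (f j, g (i + j))"
  let ?m' = "fmor F (term_at X' j, term_at Y' (i + j)) (term_at X'' j, term_at Y'' (i + j)) (f' j, g' (i + j))"
  have m: "?m \<in> Hom D ?A ?A'" "?m' \<in> Hom D ?A' ?A''"
    unfolding F_fam_def by (rule F_mor_map_closed[OF X Y X' Y' f g] F_mor_map_closed[OF X' Y' X'' Y'' f' g'])+
  have "fmor F (term_at X j, term_at Y (i + j)) (term_at X'' j, term_at Y'' (i + j)) (?f j, ?g (i + j))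
    = Comp D ?A ?A' ?A'' ?m' ?m"
    unfolding F_fam_def C.C_inf_Comp C'.C_inf_Comp
    by (rule F_mor_Comp[symmetric])
      (intro C.C_inf_term C'.C_inf_term C.C_inf_hom_closed C'.C_inf_hom_closed X Y X' Y' X'' Y'' f g f' g')+
  then have "Comp D (tot_obj X Y i) (tot_obj X'' Y'' i) ?A'' (tot_proj X'' Y'' i j) (tot_map X Y X'' Y'' ?f ?g i)
    = Comp D (tot_obj X Y i) ?A ?A'' (Comp D ?A ?A' ?A'' ?m' ?m) (tot_proj X Y i j)"
    by (simp only: tot_proj_map[OF X Y X'' Y'' fg])
  also have "\<dots> = Comp D (tot_obj X Y i) ?A' ?A'' ?m'
      (Comp D (tot_obj X Y i) ?A ?A' ?m (tot_proj X Y i j))"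
    by (intro D.Comp_assoc[symmetric] obj m pr)
  also have "\<dots> = Comp D (tot_obj X Y i) ?A' ?A'' ?m'
      (Comp D (tot_obj X Y i) (tot_obj X' Y' i) ?A' (tot_proj X' Y' i j) (tot_map X Y X' Y' f g i))"
    by (simp only: tot_proj_map[OF X Y X' Y' f g])
  also have "\<dots> = Comp D (tot_obj X Y i) (tot_obj X' Y' i) ?A''
      (Comp D (tot_obj X' Y' i) ?A' ?A'' ?m' (tot_proj X' Y' i j)) (tot_map X Y X' Y' f g i)"
    by (intro D.Comp_assoc obj m pr map)
  also have "\<dots> = Comp D (tot_obj X Y i) (tot_obj X' Y' i) ?A''
      (Comp D (tot_obj X' Y' i) (tot_obj X'' Y'' i) ?A'' (tot_proj X'' Y'' i j) (tot_map X' Y' X'' Y'' f' g' i))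
      (tot_map X Y X' Y' f g i)"
    by (simp only: tot_proj_map[OF X' Y' X'' Y'' f' g'])
  also have "\<dots> = Comp D (tot_obj X Y i) (tot_obj X'' Y'' i) ?A'' (tot_proj X'' Y'' i j) ?r"
    by (intro D.Comp_assoc[symmetric] obj pr map)
  finally show "Comp D (tot_obj X Y i) (tot_obj X'' Y'' i) ?A'' (tot_proj X'' Y'' i j) (tot_map X Y X'' Y'' ?f ?g i)
    = Comp D (tot_obj X Y i) (tot_obj X'' Y'' i) ?A'' (tot_proj X'' Y'' i j) ?r" .
qed

lemma is_functor_F_xi:
  "is_functor (prod_cat (op_cat (C_inf C)) (C_inf C')) (C_inf D) (F_xi R C C' D F \<xi>)"
proof (intro is_functor.intro is_functor_axioms.intro)
  show "category (prod_cat (op_cat (C_inf C)) (C_inf C'))"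
    by (intro category_prod_cat category_op_cat C.category_C_inf C'.category_C_inf)
  show "category (C_inf D)" by (rule D.category_C_inf)
next
  fix Z assume "Z \<in> Obj (prod_cat (op_cat (C_inf C)) (C_inf C'))"
  then obtain X Y where Z: "Z = (X, Y)" and XY: "X \<in> Obj (C_inf C)" "Y \<in> Obj (C_inf C')"
    by (cases Z) (simp add: prod_cat_def op_cat_def)
  show "fobj (F_xi R C C' D F \<xi>) Z \<in> Obj (C_inf D)"
    unfolding Z by (rule F_xi_fobj_closed[OF XY])
  have "Ident (prod_cat (op_cat (C_inf C)) (C_inf C')) Z = (Ident (C_inf C) X, Ident (C_inf C') Y)"
    by (simp add: prod_cat_def op_cat_def Z)
  then show "fmor (F_xi R C C' D F \<xi>) Z Z (Ident (prod_cat (op_cat (C_inf C)) (C_inf C')) Z)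
      = Ident (C_inf D) (fobj (F_xi R C C' D F \<xi>) Z)"
    using tot_map_Ident[OF XY] by (auto simp: Z D.C_inf_Ident tot_term[OF XY])
next
  fix Z Z' h
  assume "Z \<in> Obj (prod_cat (op_cat (C_inf C)) (C_inf C'))" "Z' \<in> Obj (prod_cat (op_cat (C_inf C)) (C_inf C'))"
    "h \<in> Hom (prod_cat (op_cat (C_inf C)) (C_inf C')) Z Z'"
  then show "fmor (F_xi R C C' D F \<xi>) Z Z' h
      \<in> Hom (C_inf D) (fobj (F_xi R C C' D F \<xi>) Z) (fobj (F_xi R C C' D F \<xi>) Z')"
    by (cases Z; cases Z'; cases h)
      (auto simp only: prod_cat_def op_cat_def cat.simps mem_Times_iff fst_conv snd_conv intro!: F_xi_fmor_closed)
next
  fix Z Z' Z'' h h'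
  assume "Z \<in> Obj (prod_cat (op_cat (C_inf C)) (C_inf C'))" "Z' \<in> Obj (prod_cat (op_cat (C_inf C)) (C_inf C'))"
    "Z'' \<in> Obj (prod_cat (op_cat (C_inf C)) (C_inf C'))"
    "h \<in> Hom (prod_cat (op_cat (C_inf C)) (C_inf C')) Z Z'" "h' \<in> Hom (prod_cat (op_cat (C_inf C)) (C_inf C')) Z' Z''"
  moreover obtain X Y X' Y' X'' Y'' f g f' g'
    where Z: "Z = (X, Y)" "Z' = (X', Y')" "Z'' = (X'', Y'')" "h = (f, g)" "h' = (f', g')"
    by (metis surj_pair)
  ultimately have XY: "X \<in> Obj (C_inf C)" "Y \<in> Obj (C_inf C')" "X' \<in> Obj (C_inf C)" "Y' \<in> Obj (C_inf C')"
    "X'' \<in> Obj (C_inf C)" "Y'' \<in> Obj (C_inf C')"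
    and fg: "f \<in> Hom (C_inf C) X' X" "g \<in> Hom (C_inf C') Y Y'"
    "f' \<in> Hom (C_inf C) X'' X'" "g' \<in> Hom (C_inf C') Y' Y''"
    by (simp_all only: prod_cat_def op_cat_def cat.simps mem_Times_iff fst_conv snd_conv)
  have "Comp (prod_cat (op_cat (C_inf C)) (C_inf C')) Z Z' Z'' h' h
    = (Comp (C_inf C) X'' X' X f f', Comp (C_inf C') Y Y' Y'' g' g)"
    by (simp only: prod_cat_def op_cat_def cat.simps fst_conv snd_conv Z)
  then show "fmor (F_xi R C C' D F \<xi>) Z Z'' (Comp (prod_cat (op_cat (C_inf C)) (C_inf C')) Z Z' Z'' h' h)
    = Comp (C_inf D) (fobj (F_xi R C C' D F \<xi>) Z) (fobj (F_xi R C C' D F \<xi>) Z') (fobj (F_xi R C C' D F \<xi>) Z'')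
        (fmor (F_xi R C C' D F \<xi>) Z' Z'' h') (fmor (F_xi R C C' D F \<xi>) Z Z' h)"
    unfolding Z D.C_inf_Comp tot_term[OF XY(1,2)] tot_term[OF XY(3,4)] tot_term[OF XY(5,6)]
    by (intro ext) (simp only: tot_map_Comp[OF XY fg])
qed

lemma is_functor_F_xi_N:
  assumes "domain R" and "allows_twisted_Leibniz R D N \<xi>"
  shows "is_functor (prod_cat (op_cat (C_N N C)) (C_N N C')) (C_N N D) (F_xi R C C' D F \<xi>)"
  unfolding C_N_def[of N D]
proof (rule is_functor_full_subcat[OF is_functor_F_xi])
  show "category (prod_cat (op_cat (C_N N C)) (C_N N C'))"
    unfolding C_N_def
    by (intro category_prod_cat category_op_cat category_full_subcat C.category_C_inf C'.category_C_inf)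
next
  fix Z assume "Z \<in> Obj (prod_cat (op_cat (C_N N C)) (C_N N C'))"
  then obtain X Y where Z: "Z = (X, Y)" and XY: "X \<in> Obj (C_inf C)" "Y \<in> Obj (C_inf C')"
    and zero: "\<And>i. zero_morphism C (term_at X i) (term_at X (i + int N)) (diff_pow C X N i)"
      "\<And>i. zero_morphism C' (term_at Y i) (term_at Y (i + int N)) (diff_pow C' Y N i)"
    by (cases Z) (auto simp: prod_cat_def op_cat_def C_N_def full_subcat_def)
  have XN: "diff_pow C X N i = \<zero>\<^bsub>HomM C (term_at X i) (term_at X (i + int N))\<^esub>" for i
    using zero(1) C.zero_morphism_iff[OF C.C_inf_term[OF XY(1)] C.C_inf_term[OF XY(1)]] by blast
  have YN: "diff_pow C' Y N i = \<zero>\<^bsub>HomM C' (term_at Y i) (term_at Y (i + int N))\<^esub>" for i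
    using zero(2) C'.zero_morphism_iff[OF C'.C_inf_term[OF XY(2)] C'.C_inf_term[OF XY(2)]] by blast
  show "\<forall>i. zero_morphism D (term_at (fobj (F_xi R C C' D F \<xi>) Z) i)
      (term_at (fobj (F_xi R C C' D F \<xi>) Z) (i + int N)) (diff_pow D (fobj (F_xi R C C' D F \<xi>) Z) N i)"
    unfolding Z tot_term[OF XY] tot_diff_pow_zero[OF XY assms XN YN]
    using D.zero_morphism_iff[OF tot_obj_closed[OF XY] tot_obj_closed[OF XY]] by simp
qed (auto simp: prod_cat_def op_cat_def C_N_def full_subcat_def)

end

theorem theorem3p15:
  fixes R :: "('r, 'x) ring_scheme"
    and C :: "('o, 'm, 'r) lin_cat"
    and C' :: "('o', 'm', 'r) lin_cat"
    and D :: "('p, 'n, 'r) lin_cat"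
    and F :: "('o \<times> 'o', 'm \<times> 'm', 'p, 'n) func"
    and \<xi> :: 'r and N :: nat
  assumes "domain R"
    and "additive_category R C"
    and "additive_category R C'"
    and "additive_category R D"
    and "has_countable_products D"
    and "\<xi> \<in> carrier R"
    and "allows_twisted_Leibniz R D N \<xi>"
    and "linear_bifunctor R C C' D F"
  shows "is_functor (prod_cat (op_cat (C_inf C)) (C_inf C')) (C_inf D) (F_xi R C C' D F \<xi>)
    \<and> is_functor (prod_cat (op_cat (C_N N C)) (C_N N C')) (C_N N D) (F_xi R C C' D F \<xi>)"
proof -
  interpret R: domain R by fact
  have "\<xi> \<in> Units R"
    using assms(7) R.primitive_root_Units R.Units_one_closed unfolding allows_twisted_Leibniz_def by blast
  then interpret twisted_bifunctor R C C' D F \<xi>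
    using assms by (intro twisted_bifunctor.intro twisted_bifunctor_axioms.intro)
  show ?thesis using is_functor_F_xi is_functor_F_xi_N assms by blast
qed

end
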